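(* Let $s\in S$ have vector of control points $\mathbf{c}=(c_1,\dots,c_n)^T\in\mathbb{R}^n$, i.e. $s=\sum_{i=1}^n c_iB_i$. Let $$\mathbb{E}_{\Xi,j_0}(s):=\min_{g\in\hat S}\|g-s\|_\Xi .$$ Let $\hat s:=\operatorname{argmin}_{g\in\hat S}\|g-s\|_\Xi$ be the best approximation of $s$ in $\hat S$ in the $\Xi$-norm, and let $\hat{\mathbf{c}}=(\hat c_1,\dots,\hat c_{n-1})^T\in\mathbb{R}^{n-1}$ be its vector of control points, i.e. $\hat s=\sum_{i=1}^{n-1}\hat c_i\hat B_i$. Split $$\mathbf{c}_{\rm first}=(c_1,\dots,c_{i_0-p-2})^T,\quad \mathbf{c}_{\rm loc}=(c_{i_0-p-1},\dots,c_{i_0-\ell})^T,\quad \mathbf{c}_{\rm last}=(c_{i_0-\ell+1},\dots,c_n)^T,$$ $$\hat{\mathbf{c}}_{\rm first}=(\hat c_1,\dots,\hat c_{i_0-p-2})^T,\quad \hat{\mathbf{c}}_{\rm loc}=(\hat c_{i_0-p-1},\dots,\hat c_{i_0-\ell-1})^T,\quad \hat{\mathbf{c}}_{\rm last}=(\hat c_{i_0-\ell},\dots,\hat c_{n-1})^T .$$ Then: (i) $\hat{\mathbf{c}}_{\rm first}=\mathbf{c}_{\rm first}$, $\hat{\mathbf{c}}_{\rm last}=\mathbf{c}_{\rm last}$, and $\hat{\mathbf{c}}_{\rm loc}\in\mathbb{R}^{p+1-\ell}$ is the least squares solution of the system $B_{\rm loc}\hat{\mathbf{c}}_{\rm loc}=E_{\rm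 loc}\mathbf{c}_{\rm loc}$. (ii) $\mathbb{E}_{\Xi,j_0}(s)=\|B_{\rm loc}\hat{\mathbf{c}}_{\rm loc}-E_{\rm loc}\mathbf{c}_{\rm loc}\|_2$.
   Context: Fix a polynomial degree $p\in\mathbb{N}$ (positive integer), breakpoints $a=\zeta_1<\zeta_2<\dots<\zeta_N=b$, and multiplicities $1\le m_j\le p+1$ for $j=2,\dots,N-1$. $S$ is the space of piecewise polynomial functions of degree $\le p$ on these breakpoints having $p-m_j$ continuous derivatives at $\zeta_j$ (no continuity required if $m_j=p+1$); $n:=\dim S=p+1+\sum_{j=2}^{N-1}m_j$. An associated $(p+1)$-basic knot vector is $\Xi=\{\xi_1,\dots,\xi_{n+p+1}\}$ with $\xi_1\le\dots\le\xi_{p+1}=\zeta_1$, followed by each interior breakpoint $\zeta_j$ repeated $m_j$ times in increasing order, followed by $\zeta_N=\xi_{n+1}\le\dots\le\xi_{n+p+1}$. $B_1,\dots,B_n$ is the B-spline basis of degree $p$ of $S$ associated with $\Xi$ (normalized to sum to one on $[a,b]$; $B_i$ is determined by $\xi_i,\dots,\xi_{i+p+1}$). The coefficients of a spline in this basis are its control points. The $\Xi$-norm of $s=\sum_{i=1}^n c_iB_i$ is $\|s\|_\Xi:=\big(\sum_{i=1}^n c_i^2\,\omega_i^2\big)^{1/2}$, where $\omega_i:=\big(\frac{\xi_{i+p+1}-\xi_i}{p+1}\big)^{1/2}$. Fix an interior breakpoint $\zeta_{j_0}$, $2\le j_0\le N-1$, and let $i_0:=p+1+\sum_{j=2}^{j_0}m_j$,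 so that $\xi_{i_0-1}\le\xi_{i_0}=\zeta_{j_0}<\xi_{i_0+1}$. Put $\ell:=m_{j_0}-1$, so $\ell+1$ is the multiplicity of $\xi_{i_0}$ in $\Xi$. Let $\hat\Xi:=\Xi\setminus\{\xi_{i_0}\}$ (one occurrence removed), let $\hat B_1,\dots,\hat B_{n-1}$ be the B-spline basis of degree $p$ associated with $\hat\Xi$, and let $\hat S\subset S$ be its span. For $j=1,\dots,p+2-\ell$ let $$\alpha_j:=\frac{\xi_{i_0}-\xi_{i_0-p-2+j}}{\xi_{i_0-1+j}-\xi_{i_0-p-2+j}},\qquad e_j:=\omega_{i_0-p-2+j}.$$ The local knot insertion matrix $A_{\rm loc}\in\mathbb{R}^{(p+2-\ell)\times(p+1-\ell)}$ has entries $(A_{\rm loc})_{j,j}=\alpha_j$ and $(A_{\rm loc})_{j+1,j}=1-\alpha_{j+1}$ for $j=1,\dots,p+1-\ell$, and all other entries zero. $E_{\rm loc}$ is the diagonal matrix with diagonal $(e_1,\dots,e_{p+2-\ell})$, and $B_{\rm loc}:=E_{\rm loc}A_{\rm loc}$. The least squares solution of $M\mathbf{x}=\mathbf{y}$ is the minimizer of $\|M\mathbf{x}-\mathbf{y}\|_2$. *)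

theory Defs
  imports "Jordan_Normal_Form.Matrix" "HOL-Computational_Algebra.Polynomial"
begin

text \<open>
  Breakpoints \<open>\<zeta>\<close>, multiplicities \<open>m\<close> and knots \<open>\<xi>\<close> are sequences indexed from 1, of which only the
  indices \<open>1..N\<close>, \<open>2..N - 1\<close> and \<open>1..n + p + 1\<close> matter.  Entry number \<open>i\<close> (counted from 1) of a
  vector \<open>c\<close> is \<open>c $ (i - 1)\<close>.  A function on \<open>[a,b]\<close> is represented by its extension by zero to
  the real line, so that equality of splines is equality of functions.
\<close>

definition spline_dim :: "nat \<Rightarrow> nat \<Rightarrow> (nat \<Rightarrow> nat) \<Rightarrow> nat" where
  "spline_dim p N m = p + 1 + (\<Sum>j = 2..N - 1. m j)"

text \<open>\<open>f\<close> has \<open>r\<close> derivatives around \<open>x\<close>, and \<open>f\<close> and these derivatives are continuous at \<open>x\<close>;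
  \<open>D k\<close> is the \<open>k\<close>-th derivative.\<close>

definition continuous_derivs_at :: "nat \<Rightarrow> (real \<Rightarrow> real) \<Rightarrow> real \<Rightarrow> bool" where
  "continuous_derivs_at r f x \<longleftrightarrow>
     (\<exists>D. D 0 = f \<and>
          (\<forall>k<r. \<forall>\<^sub>F y in nhds x. (D k has_real_derivative D (Suc k) y) (at y)) \<and>
          (\<forall>k\<le>r. isCont (D k) x))"

text \<open>The polynomial pieces live on the intervals \<open>[\<zeta> j, \<zeta> (j + 1))\<close>, the last one being closed.
  The guard \<open>m j \<le> p\<close> is needed since \<open>p - m j\<close> would be truncated to 0 for \<open>m j = p + 1\<close>.\<close>

definition spline_space ::
  "nat \<Rightarrow> nat \<Rightarrow> (nat \<Rightarrow> real) \<Rightarrow> (nat \<Rightarrow> nat) \<Rightarrow> (real \<Rightarrow> real) set" where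
  "spline_space p N \<zeta> m = {s.
     (\<forall>x. x \<notin> {\<zeta> 1..\<zeta> N} \<longrightarrow> s x = 0) \<and>
     (\<forall>j\<in>{1..<N}. \<exists>q :: real poly. degree q \<le> p \<and>
        (\<forall>x. \<zeta> j \<le> x \<and> (x < \<zeta> (j + 1) \<or> j + 1 = N \<and> x = \<zeta> N) \<longrightarrow> s x = poly q x)) \<and>
     (\<forall>j\<in>{2..N - 1}. m j \<le> p \<longrightarrow> continuous_derivs_at (p - m j) s (\<zeta> j))}"

definition basic_knot_vector ::
  "nat \<Rightarrow> nat \<Rightarrow> (nat \<Rightarrow> real) \<Rightarrow> (nat \<Rightarrow> nat) \<Rightarrow> (nat \<Rightarrow> real) \<Rightarrow> bool" where
  "basic_knot_vector p N \<zeta> m \<xi> \<longleftrightarrow>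
     mono_on {1..spline_dim p N m + p + 1} \<xi> \<and>
     \<xi> (p + 1) = \<zeta> 1 \<and>
     (\<forall>j\<in>{2..N - 1}. \<forall>k\<in>{1..m j}. \<xi> (p + 1 + (\<Sum>i = 2..<j. m i) + k) = \<zeta> j) \<and>
     \<xi> (spline_dim p N m + 1) = \<zeta> N"

text \<open>Cox--de Boor recursion.  The convention \<open>x / 0 = 0\<close> removes the terms with vanishing
  denominator.  In degree 0 the intervals \<open>[\<xi> i, \<xi> (i + 1))\<close> are used, except at the right
  endpoint \<open>x = b\<close>, where they are replaced by \<open>(\<xi> i, \<xi> (i + 1)]\<close>: the B-splines are continuous
  from the left at \<open>b\<close>.\<close>

fun cox_de_boor :: "real \<Rightarrow> (nat \<Rightarrow> real) \<Rightarrow> nat \<Rightarrow> nat \<Rightarrow> real \<Rightarrow> real" where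
  "cox_de_boor b \<xi> 0 i x =
     (if (x \<noteq> b \<and> \<xi> i \<le> x \<and> x < \<xi> (i + 1)) \<or> (x = b \<and> \<xi> i < x \<and> x \<le> \<xi> (i + 1)) then 1 else 0)"
| "cox_de_boor b \<xi> (Suc k) i x =
     (x - \<xi> i) / (\<xi> (i + k + 1) - \<xi> i) * cox_de_boor b \<xi> k i x +
     (\<xi> (i + k + 2) - x) / (\<xi> (i + k + 2) - \<xi> (i + 1)) * cox_de_boor b \<xi> k (i + 1) x"

definition bspline :: "nat \<Rightarrow> real \<Rightarrow> real \<Rightarrow> (nat \<Rightarrow> real) \<Rightarrow> nat \<Rightarrow> real \<Rightarrow> real" where
  "bspline p a b \<xi> i x = (if x \<in> {a..b} then cox_de_boor b \<xi> p i x else 0)"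

definition spline_of :: "nat \<Rightarrow> real \<Rightarrow> real \<Rightarrow> (nat \<Rightarrow> real) \<Rightarrow> real vec \<Rightarrow> real \<Rightarrow> real" where
  "spline_of p a b \<xi> c = (\<lambda>x. \<Sum>i = 1..dim_vec c. c $ (i - 1) * bspline p a b \<xi> i x)"

definition bspline_span :: "nat \<Rightarrow> real \<Rightarrow> real \<Rightarrow> (nat \<Rightarrow> real) \<Rightarrow> nat \<Rightarrow> (real \<Rightarrow> real) set" where
  "bspline_span p a b \<xi> n = spline_of p a b \<xi> ` carrier_vec n"

definition control_points ::
  "nat \<Rightarrow> real \<Rightarrow> real \<Rightarrow> (nat \<Rightarrow> real) \<Rightarrow> nat \<Rightarrow> (real \<Rightarrow> real) \<Rightarrow> real vec" where
  "control_points p a b \<xi> n s = (THE c. c \<in> carrier_vec n \<and> s = spline_of p a b \<xi> c)"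

definition knot_weight :: "nat \<Rightarrow> (nat \<Rightarrow> real) \<Rightarrow> nat \<Rightarrow> real" where
  "knot_weight p \<xi> i = sqrt ((\<xi> (i + p + 1) - \<xi> i) / real (p + 1))"

definition knot_norm ::
  "nat \<Rightarrow> real \<Rightarrow> real \<Rightarrow> (nat \<Rightarrow> real) \<Rightarrow> nat \<Rightarrow> (real \<Rightarrow> real) \<Rightarrow> real" where
  "knot_norm p a b \<xi> n s =
     sqrt (\<Sum>i = 1..n. (control_points p a b \<xi> n s $ (i - 1))\<^sup>2 * (knot_weight p \<xi> i)\<^sup>2)"

definition remove_knot :: "nat \<Rightarrow> (nat \<Rightarrow> real) \<Rightarrow> nat \<Rightarrow> real" where
  "remove_knot i0 \<xi> i = (if i < i0 then \<xi> i else \<xi> (i + 1))"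

text \<open>Here \<open>l + 1\<close> is the multiplicity of the knot \<open>\<xi> i0\<close>.  The subtraction \<open>i0 - p - 2\<close> is exact,
  as \<open>i0 \<ge> p + 2\<close> for an interior knot.\<close>

definition insertion_coeff :: "nat \<Rightarrow> nat \<Rightarrow> (nat \<Rightarrow> real) \<Rightarrow> nat \<Rightarrow> real" where
  "insertion_coeff p i0 \<xi> j =
     (\<xi> i0 - \<xi> (i0 - p - 2 + j)) / (\<xi> (i0 - 1 + j) - \<xi> (i0 - p - 2 + j))"

definition A_loc :: "nat \<Rightarrow> nat \<Rightarrow> nat \<Rightarrow> (nat \<Rightarrow> real) \<Rightarrow> real mat" where
  "A_loc p l i0 \<xi> = mat (p + 2 - l) (p + 1 - l)
     (\<lambda>(r, k). if r = k then insertion_coeff p i0 \<xi> (r + 1)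
               else if r = k + 1 then 1 - insertion_coeff p i0 \<xi> (r + 1)
               else 0)"

definition E_loc :: "nat \<Rightarrow> nat \<Rightarrow> nat \<Rightarrow> (nat \<Rightarrow> real) \<Rightarrow> real mat" where
  "E_loc p l i0 \<xi> = mat_diag (p + 2 - l) (\<lambda>r. knot_weight p \<xi> (i0 - p - 2 + (r + 1)))"

definition B_loc :: "nat \<Rightarrow> nat \<Rightarrow> nat \<Rightarrow> (nat \<Rightarrow> real) \<Rightarrow> real mat" where
  "B_loc p l i0 \<xi> = E_loc p l i0 \<xi> * A_loc p l i0 \<xi>"

definition norm2 :: "real vec \<Rightarrow> real" where
  "norm2 v = sqrt (v \<bullet> v)"

definition least_squares_solutions :: "real mat \<Rightarrow> real vec \<Rightarrow> real vec set" where
  "least_squares_solutions M y =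
     {x. is_arg_min (\<lambda>z. norm2 (M *\<^sub>v z - y)) (\<lambda>z. z \<in> carrier_vec (dim_col M)) x}"

text \<open>The vector of the entries number \<open>i, ..., j\<close> of \<open>c\<close>, counted from 1; empty for \<open>j < i\<close>.\<close>

definition subvec :: "real vec \<Rightarrow> nat \<Rightarrow> nat \<Rightarrow> real vec" where
  "subvec c i j = vec (j + 1 - i) (\<lambda>k. c $ (i + k - 1))"

end

(* Let the knot number r, of multiplicity l + 1, be removed.  Knot insertion expresses each coarse
   B-spline as a combination of two consecutive fine ones with
   weights W i and 1 - W (i + 1), so that a coarse spline with control points d has the fine control
   points W i d_i + (1 - W i) d_(i-1).  Since W i is 1 for i < r - p and 0 for i >= r - l, the squared
   norm of the error splits into independent first, local and last parts; the first and last parts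
   can be made zero, and the local part is a full rank least squares problem.
   The fine control points are unique because the B-splines are linearly independent on every
   nontrivial knot span: differentiating a vanishing combination lowers the degree and replaces the
   coefficients by their divided differences, so by induction all coefficients agree, and they
   vanish because the B-splines sum to one. *)

theory Submission
  imports Defs "Jordan_Normal_Form.Determinant"
begin

section \<open>B-splines and knot removal\<close>

declare cox_de_boor.simps(2) [simp del]

text \<open>The point \<open>b\<close> is excluded because the degree 0 intervals are closed on the
  right there, so that a B-spline can be nonzero at its last knot.\<close>

lemma cox_de_boor_support:
  assumes "mono_on {i..i + k + 1} \<xi>" "x \<noteq> b" "x < \<xi> i \<or> \<xi> (i + k + 1) \<le> x"
  shows "cox_de_boor b \<xi> k i x = 0"
  using assms
proof (induction k arbitrary: i)
  case 0
  then show ?case by auto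
next
  case (Suc k)
  have m: "mono_on {i..i + k + 1} \<xi>" "mono_on {i + 1..(i + 1) + k + 1} \<xi>"
    by (rule mono_on_subset[OF Suc.prems(1)]; auto)+
  have "\<xi> i \<le> \<xi> (i + 1)" "\<xi> (i + k + 1) \<le> \<xi> (i + k + 2)"
    by (rule mono_onD[OF Suc.prems(1)]; simp)+
  then have "cox_de_boor b \<xi> k i x = 0" "cox_de_boor b \<xi> k (i + 1) x = 0"
    using Suc.IH[OF m(1)] Suc.IH[OF m(2)] Suc.prems(2,3) by (auto simp: add.commute)
  then show ?case by (simp add: cox_de_boor.simps(2))
qed

lemma cox_de_boor_remove_later:
  "i + k + 1 < r \<Longrightarrow> cox_de_boor b (remove_knot r \<xi>) k i x = cox_de_boor b \<xi> k i x"
  by (induction k arbitrary: i) (auto simp: cox_de_boor.simps(2) remove_knot_def)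

lemma cox_de_boor_remove_earlier:
  "r \<le> i \<Longrightarrow> cox_de_boor b (remove_knot r \<xi>) k i x = cox_de_boor b \<xi> k (i + 1) x"
  by (induction k arbitrary: i) (auto simp: cox_de_boor.simps(2) remove_knot_def)

text \<open>Boehm's knot insertion, by induction on the degree: both coarse B-splines in the
  recursion are expanded in fine ones and the coefficients are compared. With
  \<open>x / 0 = 0\<close> the identity also covers repeated knots.\<close>

lemma cox_de_boor_remove_inner:
  assumes "mono_on {i..i + k + 2} \<xi>" "i < r" "r \<le> i + k + 1"
  shows "cox_de_boor b (remove_knot r \<xi>) k i x =
    (\<xi> r - \<xi> i) / (\<xi> (i + k + 1) - \<xi> i) * cox_de_boor b \<xi> k i x +
    (\<xi> (i + k + 2) - \<xi> r) / (\<xi> (i + k + 2) - \<xi> (i + 1)) * cox_de_boor b \<xi> k (i + 1) x"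
  using assms
proof (induction k arbitrary: i)
  case 0
  then have r: "r = i + 1" by simp
  have "\<xi> i \<le> \<xi> (i + 1)" "\<xi> (i + 1) \<le> \<xi> (i + 2)"
    by (rule mono_onD[OF 0(1)]; simp)+
  then show ?case
    by (cases "x = b") (auto simp: r remove_knot_def)
next
  case (Suc k)
  define B where "B = (\<lambda>i. cox_de_boor b \<xi> k i x)"
  define C where "C = (\<lambda>i. cox_de_boor b (remove_knot r \<xi>) k i x)"
  have m: "mono_on {i..i + k + 2} \<xi>" "mono_on {i + 1..(i + 1) + k + 2} \<xi>"
    by (rule mono_on_subset[OF Suc.prems(1)]; auto)+
  have le: "\<xi> i \<le> \<xi> (i + 1)" "\<xi> (i + 1) \<le> \<xi> (i + k + 2)" "\<xi> (i + k + 2) \<le> \<xi> (i + k + 3)"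
     "\<xi> (i + 1) \<le> \<xi> (i + 2)" "\<xi> (i + 2) \<le> \<xi> (i + k + 3)" "\<xi> i \<le> \<xi> (i + k + 1)"
     "\<xi> (i + k + 1) \<le> \<xi> (i + k + 2)"
    by (rule mono_onD[OF Suc.prems(1)]; simp)+
  have B: "cox_de_boor b \<xi> (Suc k) i x =
      (x - \<xi> i) / (\<xi> (i + k + 1) - \<xi> i) * B i +
      (\<xi> (i + k + 2) - x) / (\<xi> (i + k + 2) - \<xi> (i + 1)) * B (i + 1)"
    "cox_de_boor b \<xi> (Suc k) (i + 1) x =
      (x - \<xi> (i + 1)) / (\<xi> (i + k + 2) - \<xi> (i + 1)) * B (i + 1) +
      (\<xi> (i + k + 3) - x) / (\<xi> (i + k + 3) - \<xi> (i + 2)) * B (i + 2)"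
    by (simp_all add: B_def cox_de_boor.simps(2) eval_nat_numeral)
  have C: "cox_de_boor b (remove_knot r \<xi>) (Suc k) i x =
      (x - \<xi> i) / (remove_knot r \<xi> (i + k + 1) - \<xi> i) * C i +
      (\<xi> (i + k + 3) - x) / (\<xi> (i + k + 3) - remove_knot r \<xi> (i + 1)) * C (i + 1)"
    using Suc.prems(2,3) by (simp add: C_def cox_de_boor.simps(2) remove_knot_def eval_nat_numeral)
  have idx: "i + Suc k + 1 = i + k + 2" "i + Suc k + 2 = i + k + 3" by simp_all
  have left: "(x - \<xi> i) / (remove_knot r \<xi> (i + k + 1) - \<xi> i) * C i =
      (x - \<xi> i) / (\<xi> (i + k + 2) - \<xi> i) *
      ((\<xi> r - \<xi> i) / (\<xi> (i + k + 1) - \<xi> i) * B i +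
       (\<xi> (i + k + 2) - \<xi> r) / (\<xi> (i + k + 2) - \<xi> (i + 1)) * B (i + 1))"
  \<comment> \<open>For this \<open>r\<close> the induction hypothesis is out of range, but
    \<open>C i\<close> does not see the removed knot. In \<open>right\<close> the same happens for
    \<open>r = i + 1\<close>, up to an index shift.\<close>
  proof (cases "r = i + k + 2")
    case True
    then have "C i = B i" by (simp add: C_def B_def cox_de_boor_remove_later)
    moreover have "remove_knot r \<xi> (i + k + 1) = \<xi> (i + k + 1)"
      using True by (simp add: remove_knot_def)
    ultimately show ?thesis using le True by auto
  next
    case False
    then have "r \<le> i + k + 1" using Suc.prems(3) by simp
    moreover from this have "remove_knot r \<xi> (i + k + 1) = \<xi> (i + k + 2)"
      by (simp add: remove_knot_def)
    ultimately show ?thesis using Suc.IH[OF m(1) Suc.prems(2)] by (simp only: C_def B_def)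
  qed
  have right: "(\<xi> (i + k + 3) - x) / (\<xi> (i + k + 3) - remove_knot r \<xi> (i + 1)) * C (i + 1) =
      (\<xi> (i + k + 3) - x) / (\<xi> (i + k + 3) - \<xi> (i + 1)) *
      ((\<xi> r - \<xi> (i + 1)) / (\<xi> (i + k + 2) - \<xi> (i + 1)) * B (i + 1) +
       (\<xi> (i + k + 3) - \<xi> r) / (\<xi> (i + k + 3) - \<xi> (i + 2)) * B (i + 2))"
  proof (cases "r = i + 1")
    case True
    then have "C (i + 1) = B (i + 2)" by (simp add: C_def B_def cox_de_boor_remove_earlier)
    moreover have "remove_knot r \<xi> (i + 1) = \<xi> (i + 2)"
      using True by (simp add: remove_knot_def)
    ultimately show ?thesis using le True by auto
  next
    case False
    then have r: "i + 1 < r" "r \<le> (i + 1) + k + 1" using Suc.prems(2,3) by auto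
    then have "remove_knot r \<xi> (i + 1) = \<xi> (i + 1)" by (simp add: remove_knot_def)
    moreover have "i + 1 + k + 1 = i + k + 2" "i + 1 + k + 2 = i + k + 3" "i + 1 + 1 = i + 2"
      by simp_all
    ultimately show ?thesis using Suc.IH[OF m(2) r] by (simp only: C_def B_def)
  qed
  \<comment> \<open>These are the coefficients of \<open>B (i + 1)\<close> with \<open>u\<close> for
    \<open>\<xi> r\<close>. The two sides arise from each other by exchanging \<open>x\<close> and
    \<open>u\<close>; for \<open>tB = t1\<close> both are 0.\<close>
  have mid: "((x - t0) / (tB - t0) * ((tB - u) / (tB - t1)) +
        (tC - x) / (tC - t1) * ((u - t1) / (tB - t1))) =
     ((u - t0) / (tB - t0) * ((tB - x) / (tB - t1)) +
        (tC - u) / (tC - t1) * ((x - t1) / (tB - t1)))"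
    if "t0 \<le> t1" "t1 \<le> tB" "tB \<le> tC" for t0 t1 tB tC u :: real
  proof (cases "tB = t1")
    case False
    then have "tB - t0 \<noteq> 0" "tC - t1 \<noteq> 0" "tB - t1 \<noteq> 0" using that by auto
    then show ?thesis by (simp add: divide_simps) (simp add: algebra_simps)
  qed simp
  note mid = mid[OF le(1-3), of "\<xi> r"]
  have combine: "P * (Q * b\<^sub>0 + R * b\<^sub>1) + U * (V * b\<^sub>1 + W * b\<^sub>2) =
      P' * (Q' * b\<^sub>0 + R' * b\<^sub>1) + U' * (V' * b\<^sub>1 + W' * b\<^sub>2)"
    if "P * R + U * V = P' * R' + U' * V'" "P * Q = P' * Q'" "U * W = U' * W'"
    for P Q R U V W P' Q' R' U' V' W' b\<^sub>0 b\<^sub>1 b\<^sub>2 :: real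
  proof -
    have "P * (Q * b\<^sub>0 + R * b\<^sub>1) + U * (V * b\<^sub>1 + W * b\<^sub>2) =
        (P * Q) * b\<^sub>0 + (P * R + U * V) * b\<^sub>1 + (U * W) * b\<^sub>2" by (simp add: algebra_simps)
    then show ?thesis unfolding that by (simp add: algebra_simps)
  qed
  show ?case
    unfolding C left right idx B by (rule combine[OF mid]) simp_all
qed

text \<open>Up to the factor \<open>k + 1\<close> this is the B-spline of integral one. In this
  scaling the recursion and the derivative formula contain no further quotients, and a degenerate
  support gives the value 0.\<close>

definition scaled_bspline :: "real \<Rightarrow> (nat \<Rightarrow> real) \<Rightarrow> nat \<Rightarrow> nat \<Rightarrow> real \<Rightarrow> real" where
  "scaled_bspline b \<xi> k i x = cox_de_boor b \<xi> k i x / (\<xi> (i + k + 1) - \<xi> i)"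

lemma cox_de_boor_Suc_scaled:
  "cox_de_boor b \<xi> (Suc k) i x =
     (x - \<xi> i) * scaled_bspline b \<xi> k i x + (\<xi> (i + k + 2) - x) * scaled_bspline b \<xi> k (i + 1) x"
  by (simp add: cox_de_boor.simps(2) scaled_bspline_def)

section \<open>Derivatives away from the knots\<close>

lemma has_real_derivative_cox_de_boor_0:
  assumes "x \<noteq> b" "x \<noteq> \<xi> i" "x \<noteq> \<xi> (i + 1)"
  shows "(cox_de_boor b \<xi> 0 i has_real_derivative 0) (at x)"
proof -
  have same_side: "\<forall>\<^sub>F y in nhds x. y \<noteq> t \<and> (y < t \<longleftrightarrow> x < t)" if "x \<noteq> t" for t
  proof (cases "x < t")
    case True
    then have "\<forall>\<^sub>F y in nhds x. y \<in> {..<t}" by (intro eventually_nhds_in_open) auto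
    then show ?thesis by eventually_elim (use True in auto)
  next
    case False
    then have "\<forall>\<^sub>F y in nhds x. y \<in> {t<..}" using that by (intro eventually_nhds_in_open) auto
    then show ?thesis by eventually_elim (use False in auto)
  qed
  have "\<forall>\<^sub>F y in nhds x. cox_de_boor b \<xi> 0 i y = cox_de_boor b \<xi> 0 i x"
    using same_side[OF assms(1)] same_side[OF assms(2)] same_side[OF assms(3)]
  proof eventually_elim
    case (elim y)
    moreover have "\<xi> i \<le> z \<longleftrightarrow> \<not> z < \<xi> i" for z by auto
    ultimately show ?case using assms(1) by simp
  qed
  from DERIV_cong_ev[OF refl this refl] show ?thesis
    by (simp del: cox_de_boor.simps)
qed

text \<open>The product rule applied to the recursion. Staying away from the knots avoids their
  reduced smoothness and suffices on an open knot span.\<close>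

lemma has_real_derivative_cox_de_boor:
  assumes "mono_on {i..i + k + 2} \<xi>" "x \<noteq> b" "\<And>j. i \<le> j \<Longrightarrow> j \<le> i + k + 2 \<Longrightarrow> x \<noteq> \<xi> j"
  shows "(cox_de_boor b \<xi> (Suc k) i has_real_derivative
    real (Suc k) * (scaled_bspline b \<xi> k i x - scaled_bspline b \<xi> k (i + 1) x)) (at x)"
  using assms
proof (induction k arbitrary: i)
  case 0
  have D: "(scaled_bspline b \<xi> 0 j has_real_derivative 0) (at x)" if "j \<in> {i, i + 1}" for j
  proof -
    have "(cox_de_boor b \<xi> 0 j has_real_derivative 0) (at x)"
      by (rule has_real_derivative_cox_de_boor_0) (use 0(2) 0(3)[of j] 0(3)[of "j + 1"] that in auto)
    from DERIV_cdivide[OF this, of "\<xi> (j + 1) - \<xi> j"] show ?thesis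
      by (simp add: scaled_bspline_def[abs_def])
  qed
  have "((\<lambda>x. (x - \<xi> i) * scaled_bspline b \<xi> 0 i x + (\<xi> (i + 2) - x) * scaled_bspline b \<xi> 0 (i + 1) x)
     has_real_derivative scaled_bspline b \<xi> 0 i x - scaled_bspline b \<xi> 0 (i + 1) x) (at x)"
    by (rule derivative_eq_intros D refl | simp)+
  also have "(\<lambda>x. (x - \<xi> i) * scaled_bspline b \<xi> 0 i x +
        (\<xi> (i + 2) - x) * scaled_bspline b \<xi> 0 (i + 1) x) = cox_de_boor b \<xi> (Suc 0) i"
    by (rule ext) (simp only: cox_de_boor_Suc_scaled add_0_right)
  finally show ?case by simp
next
  case (Suc k)
  define M where "M = (\<lambda>i. scaled_bspline b \<xi> k i x)"
  define M' where "M' = (\<lambda>i. real (Suc k) * (M i - M (i + 1)) / (\<xi> (i + k + 2) - \<xi> i))"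
  have m: "mono_on {i..i + k + 2} \<xi>" "mono_on {i + 1..(i + 1) + k + 2} \<xi>"
    by (rule mono_on_subset[OF Suc.prems(1)]; auto)+
  have le: "\<xi> i \<le> \<xi> (i + 1)" "\<xi> (i + 1) \<le> \<xi> (i + k + 2)" "\<xi> (i + k + 2) \<le> \<xi> (i + k + 3)"
     "\<xi> (i + 1) \<le> \<xi> (i + 2)" "\<xi> (i + 2) \<le> \<xi> (i + k + 3)"
    by (rule mono_onD[OF Suc.prems(1)]; simp)+
  have D: "(scaled_bspline b \<xi> (Suc k) j has_real_derivative M' j) (at x)" if "j \<in> {i, i + 1}" for j
  proof -
    have "(cox_de_boor b \<xi> (Suc k) j has_real_derivative real (Suc k) * (M j - M (j + 1))) (at x)"
      unfolding M_def using that Suc.IH[OF m(1)] Suc.IH[OF m(2)] Suc.prems(2,3) by auto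
    from DERIV_cdivide[OF this, of "\<xi> (j + k + 2) - \<xi> j"] show ?thesis
      by (simp add: M'_def scaled_bspline_def[abs_def])
  qed
  have S: "scaled_bspline b \<xi> (Suc k) j x =
      ((x - \<xi> j) * M j + (\<xi> (j + k + 2) - x) * M (j + 1)) / (\<xi> (j + k + 2) - \<xi> j)" for j
    unfolding scaled_bspline_def[of b \<xi> "Suc k"] cox_de_boor_Suc_scaled M_def by simp
  \<comment> \<open>The recursion \<open>S\<close> eliminates \<open>M i\<close> here and
    \<open>M (i + 2)\<close> in \<open>r\<close>; the remaining terms in \<open>M (i + 1)\<close>
    cancel when both are added. On a degenerate support everything is 0.\<close>
  have l: "(x - \<xi> i) * M' i = real (Suc k) * (scaled_bspline b \<xi> (Suc k) i x - M (i + 1))"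
  proof (cases "\<xi> (i + k + 2) = \<xi> i")
    case True
    then have "M (i + 1) = 0" using le by (simp add: M_def scaled_bspline_def)
    then show ?thesis using True by (simp add: M'_def S)
  next
    case False
    then show ?thesis unfolding S M'_def by (simp add: divide_simps) (simp add: algebra_simps)
  qed
  have r: "(\<xi> (i + k + 3) - x) * M' (i + 1) =
      real (Suc k) * (M (i + 1) - scaled_bspline b \<xi> (Suc k) (i + 1) x)"
  proof (cases "\<xi> (i + k + 3) = \<xi> (i + 1)")
    case True
    then have "M (i + 1) = 0" using le by (simp add: M_def scaled_bspline_def)
    then show ?thesis using True by (simp add: M'_def S eval_nat_numeral)
  next
    case False
    have e: "i + 1 + k + 2 = i + k + 3" by simp
    show ?thesis using False unfolding S M'_def e by (simp add: divide_simps) (simp add: algebra_simps)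
  qed
  have "((\<lambda>x. (x - \<xi> i) * scaled_bspline b \<xi> (Suc k) i x +
        (\<xi> (i + k + 3) - x) * scaled_bspline b \<xi> (Suc k) (i + 1) x)
     has_real_derivative
       (scaled_bspline b \<xi> (Suc k) i x + (x - \<xi> i) * M' i) +
       ((\<xi> (i + k + 3) - x) * M' (i + 1) - scaled_bspline b \<xi> (Suc k) (i + 1) x)) (at x)"
    by (rule derivative_eq_intros D refl | simp)+
  also have "(scaled_bspline b \<xi> (Suc k) i x + (x - \<xi> i) * M' i) +
       ((\<xi> (i + k + 3) - x) * M' (i + 1) - scaled_bspline b \<xi> (Suc k) (i + 1) x) =
     real (Suc (Suc k)) * (scaled_bspline b \<xi> (Suc k) i x - scaled_bspline b \<xi> (Suc k) (i + 1) x)"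
    unfolding l r by (simp add: algebra_simps)
  also have "(\<lambda>x. (x - \<xi> i) * scaled_bspline b \<xi> (Suc k) i x +
        (\<xi> (i + k + 3) - x) * scaled_bspline b \<xi> (Suc k) (i + 1) x) = cox_de_boor b \<xi> (Suc (Suc k)) i"
    by (rule ext) (simp only: cox_de_boor_Suc_scaled[of b \<xi> "Suc k" i], simp add: eval_nat_numeral)
  finally show ?case .
qed

section \<open>Partition of unity and local linear independence\<close>

lemma scaled_bspline_boundary:
  assumes "mono_on {s..s + 2 * k + 3} \<xi>" "\<xi> (s + k + 1) < x" "x < \<xi> (s + k + 2)" "x \<noteq> b"
  shows "scaled_bspline b \<xi> k s x = 0" "scaled_bspline b \<xi> k (s + k + 2) x = 0"
proof -
  have "mono_on {s..s + k + 1} \<xi>" "mono_on {s + k + 2..s + k + 2 + k + 1} \<xi>"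
    by (rule mono_on_subset[OF assms(1)]; auto)+
  then show "scaled_bspline b \<xi> k s x = 0" "scaled_bspline b \<xi> k (s + k + 2) x = 0"
    using assms by (auto simp: scaled_bspline_def intro!: cox_de_boor_support)
qed

text \<open>Collects the coefficient of each \<open>h i\<close>. The vanishing end terms, supplied
  by \<open>scaled_bspline_boundary\<close>, leave one summand fewer, which matches the drop of the
  degree by one.\<close>

lemma sum_by_parts_shift:
  fixes f g h :: "nat \<Rightarrow> real"
  assumes "h s = 0" "h (s + k + 2) = 0"
  shows "(\<Sum>i = s..s + k + 1. f i * h i + g i * h (i + 1)) =
    (\<Sum>i = s + 1..s + 1 + k. (f i + g (i - 1)) * h i)"
proof -
  have "(\<Sum>i = s..s + k + 1. f i * h i) = (\<Sum>i = s + 1..s + k + 1. f i * h i)"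
    using assms(1) by (simp add: sum.atLeast_Suc_atMost)
  moreover have "(\<Sum>i = s..s + k + 1. g i * h (i + 1)) = (\<Sum>i = s + 1..s + k + 2. g (i - 1) * h i)"
    using sum.shift_bounds_cl_Suc_ivl[of "\<lambda>i. g (i - 1) * h i" s "s + k + 1"] by simp
  moreover have "\<dots> = (\<Sum>i = s + 1..s + k + 1. g (i - 1) * h i)"
    using assms(2) by simp
  ultimately show ?thesis by (simp add: sum.distrib distrib_right add.commute)
qed

text \<open>After summation by parts the factor of each scaled B-spline is the length of its
  support, so the scaling cancels and the sum of degree \<open>k\<close> remains.\<close>

lemma cox_de_boor_partition_of_unity:
  assumes "mono_on {s..s + 2 * k + 1} \<xi>" "\<xi> (s + k) < x" "x < \<xi> (s + k + 1)" "x \<noteq> b"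
  shows "(\<Sum>i = s..s + k. cox_de_boor b \<xi> k i x) = 1"
  using assms
proof (induction k arbitrary: s)
  case 0
  then show ?case by simp
next
  case (Suc k)
  have bd: "scaled_bspline b \<xi> k s x = 0" "scaled_bspline b \<xi> k (s + k + 2) x = 0"
    using Suc.prems scaled_bspline_boundary[of s k \<xi> x b] by (auto simp: eval_nat_numeral)
  have m: "mono_on {s + 1..(s + 1) + 2 * k + 1} \<xi>"
    by (rule mono_on_subset[OF Suc.prems(1)]) auto
  have lt: "\<xi> i < \<xi> (i + k + 1)" if "i \<in> {s + 1..s + 1 + k}" for i
  proof -
    have "\<xi> i \<le> \<xi> (s + Suc k)" "\<xi> (s + Suc k + 1) \<le> \<xi> (i + k + 1)"
      by (rule mono_onD[OF Suc.prems(1)]; use that in simp)+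
    then show ?thesis using Suc.prems(2,3) by simp
  qed
  have "(\<Sum>i = s..s + Suc k. cox_de_boor b \<xi> (Suc k) i x) =
    (\<Sum>i = s..s + k + 1. (x - \<xi> i) * scaled_bspline b \<xi> k i x +
      (\<xi> (i + k + 2) - x) * scaled_bspline b \<xi> k (i + 1) x)"
    by (simp only: cox_de_boor_Suc_scaled) simp
  also have "\<dots> = (\<Sum>i = s + 1..s + 1 + k.
      ((x - \<xi> i) + (\<xi> (i - 1 + k + 2) - x)) * scaled_bspline b \<xi> k i x)"
    by (rule sum_by_parts_shift[OF bd])
  also have "\<dots> = (\<Sum>i = s + 1..s + 1 + k. cox_de_boor b \<xi> k i x)"
  proof (rule sum.cong)
    fix i assume i: "i \<in> {s + 1..s + 1 + k}"
    then have "i - 1 + k + 2 = i + k + 1" by auto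
    then show "((x - \<xi> i) + (\<xi> (i - 1 + k + 2) - x)) * scaled_bspline b \<xi> k i x =
        cox_de_boor b \<xi> k i x"
      using lt[OF i] by (simp add: scaled_bspline_def)
  qed simp
  also have "\<dots> = 1" using Suc.IH[OF m] Suc.prems by simp
  finally show ?case .
qed

text \<open>The \<open>k + 1\<close> listed B-splines are those whose supports contain the knot
  span. The bound by \<open>b\<close> keeps the open span away from the point where the degree 0
  intervals change.\<close>

lemma cox_de_boor_locally_independent:
  fixes c :: "nat \<Rightarrow> real"
  assumes "mono_on {s..s + 2 * k + 1} \<xi>" "\<xi> (s + k) < \<xi> (s + k + 1)" "\<xi> (s + k + 1) \<le> b"
    and "\<And>x. \<xi> (s + k) < x \<Longrightarrow> x < \<xi> (s + k + 1) \<Longrightarrow> (\<Sum>i = s..s + k. c i * cox_de_boor b \<xi> k i x) = 0"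
    and "i \<in> {s..s + k}"
  shows "c i = 0"
  using assms
proof (induction k arbitrary: s c i)
  case 0
  have "cox_de_boor b \<xi> 0 s ((\<xi> s + \<xi> (s + 1)) / 2) = 1" using 0(2,3) by auto
  then show ?case using 0(2) 0(4)[of "(\<xi> s + \<xi> (s + 1)) / 2"] 0(5) by auto
next
  case (Suc k)
  \<comment> \<open>The coefficients of the derivative in degree \<open>k\<close>, without the
    common nonzero factor \<open>Suc k\<close>.\<close>
  define d where "d = (\<lambda>i. (c i - c (i - 1)) / (\<xi> (i + k + 1) - \<xi> i))"
  have lt: "\<xi> i < \<xi> (i + k + 1)" if "i \<in> {s + 1..s + 1 + k}" for i
  proof -
    have "\<xi> i \<le> \<xi> (s + Suc k)" "\<xi> (s + Suc k + 1) \<le> \<xi> (i + k + 1)"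
      by (rule mono_onD[OF Suc.prems(1)]; use that in simp)+
    then show ?thesis using Suc.prems(2) by simp
  qed
  have d0: "d i = 0" if i: "i \<in> {s + 1..s + 1 + k}" for i
  proof (rule Suc.IH)
    show "mono_on {s + 1..s + 1 + 2 * k + 1} \<xi>"
      by (rule mono_on_subset[OF Suc.prems(1)]) auto
    show "\<xi> (s + 1 + k) < \<xi> (s + 1 + k + 1)" "\<xi> (s + 1 + k + 1) \<le> b"
      using Suc.prems by simp_all
    fix x assume x: "\<xi> (s + 1 + k) < x" "x < \<xi> (s + 1 + k + 1)"
    have xb: "x \<noteq> b" using x Suc.prems(3) by simp
    have xk: "x \<noteq> \<xi> j" if "s \<le> j" "j \<le> s + 2 * k + 3" for j
    proof (cases "j \<le> s + 1 + k")
      case True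
      have "\<xi> j \<le> \<xi> (s + 1 + k)" by (rule mono_onD[OF Suc.prems(1)]; use that True in simp)
      then show ?thesis using x by simp
    next
      case False
      have "\<xi> (s + 1 + k + 1) \<le> \<xi> j" by (rule mono_onD[OF Suc.prems(1)]; use that False in simp)
      then show ?thesis using x by simp
    qed
    have bd: "scaled_bspline b \<xi> k s x = 0" "scaled_bspline b \<xi> k (s + k + 2) x = 0"
      using Suc.prems(1) x xb scaled_bspline_boundary[of s k \<xi> x b] by (auto simp: eval_nat_numeral)
    have "(cox_de_boor b \<xi> (Suc k) j has_real_derivative
       real (Suc k) * (scaled_bspline b \<xi> k j x - scaled_bspline b \<xi> k (j + 1) x)) (at x)"
      if "j \<in> {s..s + Suc k}" for j
    proof (rule has_real_derivative_cox_de_boor)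
      show "mono_on {j..j + k + 2} \<xi>"
        by (rule mono_on_subset[OF Suc.prems(1)]) (use that in auto)
    qed (use xb xk that in auto)
    then have "((\<lambda>x. \<Sum>j = s..s + Suc k. c j * cox_de_boor b \<xi> (Suc k) j x) has_real_derivative
       (\<Sum>j = s..s + Suc k. c j * (real (Suc k) *
         (scaled_bspline b \<xi> k j x - scaled_bspline b \<xi> k (j + 1) x)))) (at x)"
      by (intro DERIV_sum DERIV_cmult) auto
    moreover have "((\<lambda>x. \<Sum>j = s..s + Suc k. c j * cox_de_boor b \<xi> (Suc k) j x)
        has_real_derivative 0) (at x)"
      by (rule has_field_derivative_transform_within_open[of "\<lambda>_. 0" 0 x
            "{\<xi> (s + 1 + k)<..<\<xi> (s + 1 + k + 1)}"]) (use x Suc.prems(4) in \<open>auto\<close>)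
    ultimately have "0 = (\<Sum>j = s..s + Suc k. c j * (real (Suc k) *
         (scaled_bspline b \<xi> k j x - scaled_bspline b \<xi> k (j + 1) x)))"
      using DERIV_unique by blast
    also have "\<dots> = real (Suc k) * (\<Sum>j = s..s + k + 1. c j * scaled_bspline b \<xi> k j x +
         - c j * scaled_bspline b \<xi> k (j + 1) x)"
      unfolding sum_distrib_left by (rule sum.cong) (auto simp: algebra_simps)
    also have "\<dots> = real (Suc k) * (\<Sum>j = s + 1..s + 1 + k. (c j + - c (j - 1)) * scaled_bspline b \<xi> k j x)"
      by (subst sum_by_parts_shift[OF bd]) simp
    also have "(\<Sum>j = s + 1..s + 1 + k. (c j + - c (j - 1)) * scaled_bspline b \<xi> k j x) =
        (\<Sum>j = s + 1..s + 1 + k. d j * cox_de_boor b \<xi> k j x)"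
      by (rule sum.cong) (auto simp: d_def scaled_bspline_def)
    finally show "(\<Sum>j = s + 1..s + 1 + k. d j * cox_de_boor b \<xi> k j x) = 0" by simp
  qed (use i in simp)
  have const: "c (s + t) = c s" if "t \<le> Suc k" for t
    using that
  proof (induction t)
    case (Suc t)
    then have "d (s + Suc t) = 0" by (intro d0) auto
    then show ?case using lt[of "s + Suc t"] Suc by (auto simp: d_def)
  qed simp
  have ci: "c j = c s" if "j \<in> {s..s + Suc k}" for j
    using const[of "j - s"] that by auto
  \<comment> \<open>Any point of the open span serves: there the partition of unity turns the
    combination with constant coefficients into \<open>c s\<close>.\<close>
  define x where "x = (\<xi> (s + Suc k) + \<xi> (s + Suc k + 1)) / 2"
  have x: "\<xi> (s + Suc k) < x" "x < \<xi> (s + Suc k + 1)" "x \<noteq> b"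
    using Suc.prems(2,3) by (auto simp: x_def)
  have "0 = (\<Sum>i = s..s + Suc k. c i * cox_de_boor b \<xi> (Suc k) i x)"
    using Suc.prems(4) x by simp
  also have "\<dots> = (\<Sum>i = s..s + Suc k. c s * cox_de_boor b \<xi> (Suc k) i x)"
  proof (rule sum.cong)
    fix i assume "i \<in> {s..s + Suc k}"
    then show "c i * cox_de_boor b \<xi> (Suc k) i x = c s * cox_de_boor b \<xi> (Suc k) i x"
      using ci[of i] by simp
  qed simp
  also have "\<dots> = c s * (\<Sum>i = s..s + Suc k. cox_de_boor b \<xi> (Suc k) i x)"
    by (rule sum_distrib_left[symmetric])
  also have "\<dots> = c s"
    unfolding cox_de_boor_partition_of_unity[OF Suc.prems(1) x] by simp
  finally show ?case using ci[OF Suc.prems(5)] by simp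
qed

section \<open>Least squares problems\<close>

text \<open>Turns strict inequalities into uniqueness of the minimizer, both for the local least
  squares problem and for the spline problem.\<close>

lemma is_arg_min_strict:
  fixes f :: "'a \<Rightarrow> 'b :: preorder"
  assumes "P x" "\<And>z. P z \<Longrightarrow> z \<noteq> x \<Longrightarrow> f x < f z"
  shows "is_arg_min f P z \<longleftrightarrow> z = x"
  unfolding is_arg_min_def using assms by (metis less_asym less_irrefl)

lemma scalar_prod_self_pos:
  fixes v :: "real vec"
  assumes "v \<in> carrier_vec n" "v \<noteq> 0\<^sub>v n"
  shows "0 < v \<bullet> v"
proof -
  obtain i where i: "i < n" "v $ i \<noteq> 0"
    using assms by (metis carrier_vecD eq_vecI index_zero_vec)
  have "0 < (\<Sum>i = 0..<n. v $ i * v $ i)"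
    by (rule sum_pos2[of _ i]) (use i in \<open>auto simp: zero_less_mult_iff\<close>)
  then show ?thesis using assms(1) by (simp add: scalar_prod_def)
qed

text \<open>The Gram matrix is invertible because its kernel is that of \<open>M\<close>, so the
  normal equations have a solution \<open>x\<close>. Its residual is orthogonal to the range of
  \<open>M\<close>, and Pythagoras gives the strict inequality.\<close>

lemma full_rank_least_squares:
  fixes M :: "real mat"
  assumes M: "M \<in> carrier_mat nr nc" and y: "y \<in> carrier_vec nr"
    and inj: "\<And>x. x \<in> carrier_vec nc \<Longrightarrow> M *\<^sub>v x = 0\<^sub>v nr \<Longrightarrow> x = 0\<^sub>v nc"
  obtains x where "x \<in> carrier_vec nc"
    and "\<And>z. z \<in> carrier_vec nc \<Longrightarrow> z \<noteq> x \<Longrightarrow> norm2 (M *\<^sub>v x - y) < norm2 (M *\<^sub>v z - y)"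
proof -
  let ?G = "M\<^sup>T * M"
  have G: "?G \<in> carrier_mat nc nc" using M by simp
  have pos: "0 < (M *\<^sub>v x) \<bullet> (M *\<^sub>v x)" if "x \<in> carrier_vec nc" "x \<noteq> 0\<^sub>v nc" for x
    using that inj[of x] M by (intro scalar_prod_self_pos[of _ nr]) auto
  have adj: "(M *\<^sub>v u) \<bullet> w = u \<bullet> (M\<^sup>T *\<^sub>v w)" if "u \<in> carrier_vec nc" "w \<in> carrier_vec nr" for u w
  proof -
    have "(M *\<^sub>v u) \<bullet> w = w \<bullet> (M *\<^sub>v u)"
      using that M by (intro comm_scalar_prod[of _ nr]) auto
    also have "\<dots> = (M\<^sup>T *\<^sub>v w) \<bullet> u" using transpose_vec_mult_scalar[OF M that] by simp
    also have "\<dots> = u \<bullet> (M\<^sup>T *\<^sub>v w)"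
      using that M by (intro comm_scalar_prod[of _ nc]) auto
    finally show ?thesis .
  qed
  have "det ?G \<noteq> 0"
  proof
    assume "det ?G = 0"
    then obtain v where v: "v \<in> carrier_vec nc" "v \<noteq> 0\<^sub>v nc" "?G *\<^sub>v v = 0\<^sub>v nc"
      using det_0_iff_vec_prod_zero_field[OF G] by blast
    have "(M *\<^sub>v v) \<bullet> (M *\<^sub>v v) = v \<bullet> (?G *\<^sub>v v)"
      using M v by (subst adj) auto
    then show False using v pos[of v] by simp
  qed
  \<comment> \<open>The argument \<open>()\<close> only fills the extension field of the matrix ring
    record.\<close>
  from det_non_zero_imp_unit[OF G this, of "()"] obtain H
    where H: "H \<in> carrier_mat nc nc" "?G * H = 1\<^sub>m nc"
    unfolding Units_def ring_mat_def by auto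
  define x where "x = H *\<^sub>v (M\<^sup>T *\<^sub>v y)"
  have x: "x \<in> carrier_vec nc" using H M y by (simp add: x_def)
  have normal: "M\<^sup>T *\<^sub>v (M *\<^sub>v x) = M\<^sup>T *\<^sub>v y"
  proof -
    have "M\<^sup>T *\<^sub>v (M *\<^sub>v x) = ?G *\<^sub>v x" using M x by simp
    also have "\<dots> = (?G * H) *\<^sub>v (M\<^sup>T *\<^sub>v y)"
      unfolding x_def by (rule assoc_mult_mat_vec[symmetric]) (use G H M y in auto)
    finally show ?thesis using H M y by simp
  qed
  have "norm2 (M *\<^sub>v x - y) < norm2 (M *\<^sub>v z - y)" if z: "z \<in> carrier_vec nc" "z \<noteq> x" for z
  proof -
    let ?r = "M *\<^sub>v x - y" and ?d = "M *\<^sub>v (z - x)"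
    have r: "?r \<in> carrier_vec nr" and d: "?d \<in> carrier_vec nr" using M x y z by auto
    have zx: "z - x \<in> carrier_vec nc" using x z by simp
    have "z - x \<noteq> 0\<^sub>v nc"
    proof
      assume "z - x = 0\<^sub>v nc"
      then have "(z - x) $ i = 0" if "i < nc" for i using that by simp
      then have "z = x" using x z(1) by (intro eq_vecI) auto
      then show False using z by simp
    qed
    then have "0 < ?d \<bullet> ?d" using pos zx by blast
    moreover have "?d \<bullet> ?r = 0"
    proof -
      have "M\<^sup>T *\<^sub>v ?r = M\<^sup>T *\<^sub>v (M *\<^sub>v x) - M\<^sup>T *\<^sub>v y"
        using M x y by (intro mult_minus_distrib_mat_vec) auto
      also have "\<dots> = 0\<^sub>v nc" using normal M y by auto
      finally show ?thesis using adj[OF zx r] zx by simp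
    qed
    moreover have "M *\<^sub>v z - y = ?d + ?r"
      using M x y z by (auto simp: mult_minus_distrib_mat_vec[OF M z(1) x])
    moreover have "(?d + ?r) \<bullet> (?d + ?r) = ?d \<bullet> ?d + 2 * (?d \<bullet> ?r) + ?r \<bullet> ?r"
      using r d by (simp add: add_scalar_prod_distrib[of _ nr] scalar_prod_add_distrib[of _ nr]
          comm_scalar_prod[OF r d])
    ultimately show ?thesis by (simp add: norm2_def)
  qed
  with x that show thesis by blast
qed

lemma mat_diag_mult_vec:
  fixes v :: "real vec"
  assumes "v \<in> carrier_vec n" "k < n"
  shows "(mat_diag n f *\<^sub>v v) $ k = f k * v $ k"
proof -
  have "(mat_diag n f *\<^sub>v v) $ k = (\<Sum>j = 0..<n. (if k = j then f j else 0) * v $ j)"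
    using assms by (simp add: mat_diag_def scalar_prod_def)
  also have "\<dots> = (\<Sum>j = 0..<n. if j = k then f j * v $ j else 0)"
    by (rule sum.cong) auto
  also have "\<dots> = f k * v $ k" using assms by (subst sum.delta) auto
  finally show ?thesis .
qed

section \<open>Best approximation after removing a knot\<close>

text \<open>Extends the local coefficients to all indices, by 1 on the left and 0 on the right, so
  that one two-term formula also covers the B-splines that are merely kept or renumbered.\<close>

definition insertion_weight :: "nat \<Rightarrow> nat \<Rightarrow> (nat \<Rightarrow> real) \<Rightarrow> nat \<Rightarrow> real" where
  "insertion_weight p r \<xi> i =
     (if i + p + 1 \<le> r then 1 else if r \<le> i then 0 else (\<xi> r - \<xi> i) / (\<xi> (i + p + 1) - \<xi> i))"

text \<open>For \<open>r = i + p + 1\<close> and \<open>r = i + 1\<close> a guard of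
  \<open>insertion_weight\<close> applies instead of the quotient; the two agree because the
  supports are nondegenerate.\<close>

lemma bspline_remove_knot:
  assumes "mono_on {i..i + p + 2} \<xi>" "\<xi> i < \<xi> (i + p + 1)" "\<xi> (i + 1) < \<xi> (i + p + 2)"
  shows "bspline p a b (remove_knot r \<xi>) i x =
    insertion_weight p r \<xi> i * bspline p a b \<xi> i x +
    (1 - insertion_weight p r \<xi> (i + 1)) * bspline p a b \<xi> (i + 1) x"
proof -
  consider "i + p + 1 < r" | "r \<le> i" | "i < r" "r \<le> i + p + 1" by linarith
  then show ?thesis
  proof cases
    case 1
    then show ?thesis
      by (simp add: bspline_def insertion_weight_def cox_de_boor_remove_later)
  next
    case 2
    then show ?thesis
      by (simp add: bspline_def insertion_weight_def cox_de_boor_remove_earlier)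
  next
    case 3
    have "insertion_weight p r \<xi> i = (\<xi> r - \<xi> i) / (\<xi> (i + p + 1) - \<xi> i)"
    proof (cases "r = i + p + 1")
      case False
      with 3 show ?thesis by (simp add: insertion_weight_def)
    qed (use assms in \<open>simp add: insertion_weight_def\<close>)
    moreover have "1 - insertion_weight p r \<xi> (i + 1) =
        (\<xi> (i + p + 2) - \<xi> r) / (\<xi> (i + p + 2) - \<xi> (i + 1))"
    proof (cases "r = i + 1")
      case False
      with 3 assms show ?thesis by (simp add: insertion_weight_def field_simps)
    qed (use assms in \<open>simp add: insertion_weight_def\<close>)
    ultimately show ?thesis
      using cox_de_boor_remove_inner[OF assms(1) 3] by (simp add: bspline_def)
  qed
qed

text \<open>For \<open>p + 2 \<le> r \<le> n\<close> the out-of-range entry \<open>d $ (n - 1)\<close> and the truncated index \<open>0 - 1\<close>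
  are harmless, as their weights vanish.\<close>

definition insert_control_points ::
  "nat \<Rightarrow> nat \<Rightarrow> nat \<Rightarrow> (nat \<Rightarrow> real) \<Rightarrow> real vec \<Rightarrow> real vec" where
  "insert_control_points p n r \<xi> d = vec n (\<lambda>k. insertion_weight p r \<xi> (k + 1) * d $ k +
     (1 - insertion_weight p r \<xi> (k + 1)) * d $ (k - 1))"

text \<open>The assumption \<open>span\<close> places a nontrivial knot span of the basic interval
  inside the support of every B-spline. Local independence on that span then controls its
  coefficient.\<close>

locale regular_knots =
  fixes p n :: nat and \<xi> :: "nat \<Rightarrow> real"
  assumes mono: "mono_on {1..n + p + 1} \<xi>"
    and span: "\<And>i. i \<in> {1..n} \<Longrightarrow> \<exists>j\<in>{p + 1..n}. i \<le> j \<and> j \<le> i + p \<and> \<xi> j < \<xi> (j + 1)"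
begin

section \<open>Linear independence and uniqueness of control points\<close>

lemma knot_le: "1 \<le> i \<Longrightarrow> i \<le> j \<Longrightarrow> j \<le> n + p + 1 \<Longrightarrow> \<xi> i \<le> \<xi> j"
  by (rule mono_onD[OF mono]) auto

lemma knot_less:
  assumes "i \<in> {1..n}"
  shows "\<xi> i < \<xi> (i + p + 1)"
proof -
  obtain j where "j \<in> {p + 1..n}" "i \<le> j" "j \<le> i + p" "\<xi> j < \<xi> (j + 1)"
    using span[OF assms] by blast
  moreover from this have "\<xi> i \<le> \<xi> j" "\<xi> (j + 1) \<le> \<xi> (i + p + 1)"
    using assms by (auto intro!: knot_le)
  ultimately show ?thesis by linarith
qed

lemma knot_weight_pos: "i \<in> {1..n} \<Longrightarrow> 0 < knot_weight p \<xi> i"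
  using knot_less[of i] by (simp add: knot_weight_def)

abbreviation "spline \<equiv> spline_of p (\<xi> (p + 1)) (\<xi> (n + 1)) \<xi>"

lemma bspline_independent:
  assumes zero: "\<And>x. (\<Sum>i = 1..n. c i * bspline p (\<xi> (p + 1)) (\<xi> (n + 1)) \<xi> i x) = 0"
    and i: "i \<in> {1..n}"
  shows "c i = (0 :: real)"
proof -
  obtain j where j: "j \<in> {p + 1..n}" "i \<le> j" "j \<le> i + p" "\<xi> j < \<xi> (j + 1)"
    using span[OF i] by blast
  \<comment> \<open>On the span that starts at \<open>\<xi> j\<close> only the B-splines number
    \<open>j - p\<close> to \<open>j\<close> are nonzero; the subtraction is exact since
    \<open>p + 1 \<le> j\<close>.\<close>
  define s where "s = j - p"
  have s: "1 \<le> s" "s + p = j" using j by (auto simp: s_def)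
  have bnd: "\<xi> (p + 1) \<le> \<xi> j" "\<xi> (j + 1) \<le> \<xi> (n + 1)" using j(1) by (auto intro!: knot_le)
  show ?thesis
  proof (rule cox_de_boor_locally_independent[where k = p and s = s and b = "\<xi> (n + 1)"])
    show "mono_on {s..s + 2 * p + 1} \<xi>"
      by (rule mono_on_subset[OF mono]) (use j s in auto)
    show "\<xi> (s + p) < \<xi> (s + p + 1)" "\<xi> (s + p + 1) \<le> \<xi> (n + 1)" "i \<in> {s..s + p}"
      using j s bnd by simp_all
    fix x assume "\<xi> (s + p) < x" "x < \<xi> (s + p + 1)"
    then have x: "\<xi> j < x" "x < \<xi> (j + 1)" using s by simp_all
    have outside: "cox_de_boor (\<xi> (n + 1)) \<xi> p i x = 0" if i: "i \<in> {1..n} - {s..s + p}" for i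
    proof (rule cox_de_boor_support)
      show "mono_on {i..i + p + 1} \<xi>"
        by (rule mono_on_subset[OF mono]) (use i in auto)
      show "x \<noteq> \<xi> (n + 1)" using x bnd by simp
      show "x < \<xi> i \<or> \<xi> (i + p + 1) \<le> x"
      proof (cases "i < s")
        case True
        then have "\<xi> (i + p + 1) \<le> \<xi> j" using i j s by (intro knot_le) auto
        then show ?thesis using x by simp
      next
        case False
        then have "\<xi> (j + 1) \<le> \<xi> i" using i j s by (intro knot_le) auto
        then show ?thesis using x by simp
      qed
    qed
    have "(\<Sum>i = s..s + p. c i * cox_de_boor (\<xi> (n + 1)) \<xi> p i x) =
        (\<Sum>i = 1..n. c i * cox_de_boor (\<xi> (n + 1)) \<xi> p i x)"
      using outside s j(1) by (intro sum.mono_neutral_left) auto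
    also have "\<dots> = 0"
      using zero[of x] x bnd by (simp add: bspline_def)
    finally show "(\<Sum>i = s..s + p. c i * cox_de_boor (\<xi> (n + 1)) \<xi> p i x) = 0" .
  qed
qed

lemma spline_diff:
  assumes "u \<in> carrier_vec n" "v \<in> carrier_vec n"
  shows "(\<lambda>x. spline u x - spline v x) = spline (u - v)"
proof
  fix x
  have "(\<Sum>i = 1..n. (u - v) $ (i - 1) * bspline p (\<xi> (p + 1)) (\<xi> (n + 1)) \<xi> i x) =
    (\<Sum>i = 1..n. u $ (i - 1) * bspline p (\<xi> (p + 1)) (\<xi> (n + 1)) \<xi> i x -
                 v $ (i - 1) * bspline p (\<xi> (p + 1)) (\<xi> (n + 1)) \<xi> i x)"
    by (rule sum.cong) (use assms in \<open>auto simp: algebra_simps\<close>)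
  then show "spline u x - spline v x = spline (u - v) x"
    using assms by (simp add: spline_of_def sum_subtractf)
qed

lemma spline_inj:
  assumes "u \<in> carrier_vec n" "v \<in> carrier_vec n" "spline u = spline v"
  shows "u = v"
proof (rule eq_vecI)
  fix k assume "k < dim_vec v"
  then have k: "k + 1 \<in> {1..n}" using assms by simp
  have d: "spline (u - v) x = 0" for x
    using spline_diff[OF assms(1,2)] assms(3) by (metis diff_self)
  have "(u - v) $ (k + 1 - 1) = 0"
    by (rule bspline_independent[OF _ k, where c = "\<lambda>i. (u - v) $ (i - 1)"])
      (use d assms in \<open>simp add: spline_of_def\<close>)
  then show "u $ k = v $ k" using k assms by simp
qed (use assms in simp)

lemma control_points_spline:
  assumes "u \<in> carrier_vec n"
  shows "control_points p (\<xi> (p + 1)) (\<xi> (n + 1)) \<xi> n (spline u) = u"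
  unfolding control_points_def using assms spline_inj by (intro the_equality) auto

end

text \<open>By monotonicity, \<open>multiple\<close> says that among the knots up to index
  \<open>r\<close> exactly those numbered \<open>r - l\<close> to \<open>r\<close> have the value
  \<open>\<xi> r\<close>.\<close>

locale removable_knot = regular_knots +
  fixes r l :: nat
  assumes r: "p + 2 \<le> r" "r \<le> n" and l: "l \<le> p"
    and multiple: "\<xi> (r - l) = \<xi> r" "\<xi> (r - l - 1) < \<xi> r"
begin

section \<open>Control points and weights under knot insertion\<close>

abbreviation "W \<equiv> insertion_weight p r \<xi>"
abbreviation "insertion \<equiv> insert_control_points p n r \<xi>"
abbreviation "coarse_spline \<equiv> spline_of p (\<xi> (p + 1)) (\<xi> (n + 1)) (remove_knot r \<xi>)"

lemma coarse_spline_eq: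
  assumes d: "d \<in> carrier_vec (n - 1)"
  shows "coarse_spline d = spline (insertion d)"
proof
  fix x
  obtain n' where n': "n = Suc n'" "1 \<le> n'" using r by (cases n) auto
  let ?B = "\<lambda>i. bspline p (\<xi> (p + 1)) (\<xi> (n + 1)) \<xi> i x"
  \<comment> \<open>These end values allow both sums to be extended to \<open>{1..n}\<close>: the
    added term is number \<open>n\<close> in the first sum and number 1 in the second.\<close>
  have W: "W (Suc n') = 0" "W 1 = 1" using r n' by (auto simp: insertion_weight_def)
  have "coarse_spline d x = (\<Sum>i = 1..n'. d $ (i - 1) * (W i * ?B i + (1 - W (i + 1)) * ?B (i + 1)))"
    unfolding spline_of_def
  proof (rule sum.cong)
    fix i assume i: "i \<in> {1..n'}"
    have "mono_on {i..i + p + 2} \<xi>"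
      by (rule mono_on_subset[OF mono]) (use i n' in auto)
    moreover have "\<xi> i < \<xi> (i + p + 1)" "\<xi> (i + 1) < \<xi> (i + p + 2)"
      using knot_less[of i] knot_less[of "i + 1"] i n' by auto
    ultimately show "d $ (i - 1) * bspline p (\<xi> (p + 1)) (\<xi> (n + 1)) (remove_knot r \<xi>) i x =
        d $ (i - 1) * (W i * ?B i + (1 - W (i + 1)) * ?B (i + 1))"
      by (simp add: bspline_remove_knot)
  qed (use d n' in simp)
  also have "\<dots> = (\<Sum>i = 1..n'. W i * d $ (i - 1) * ?B i) +
      (\<Sum>i = 1..n'. (1 - W (i + 1)) * d $ (i + 1 - 2) * ?B (i + 1))"
    by (simp add: sum.distrib[symmetric] algebra_simps)
  also have "(\<Sum>i = 1..n'. W i * d $ (i - 1) * ?B i) = (\<Sum>i = 1..n. W i * d $ (i - 1) * ?B i)"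
    using W n' by simp
  also have "(\<Sum>i = 1..n'. (1 - W (i + 1)) * d $ (i + 1 - 2) * ?B (i + 1)) =
      (\<Sum>i = 2..n. (1 - W i) * d $ (i - 2) * ?B i)"
    using sum.shift_bounds_cl_Suc_ivl[of "\<lambda>i. (1 - W i) * d $ (i - 2) * ?B i" 1 n'] n'
    by (simp add: eval_nat_numeral)
  also have "\<dots> = (\<Sum>i = 1..n. (1 - W i) * d $ (i - 2) * ?B i)"
    using sum.atLeast_Suc_atMost[of 1 n "\<lambda>i. (1 - W i) * d $ (i - 2) * ?B i"] W r
    by (simp add: numeral_2_eq_2)
  also have "(\<Sum>i = 1..n. W i * d $ (i - 1) * ?B i) + \<dots> =
      (\<Sum>i = 1..n. insertion d $ (i - 1) * ?B i)"
    unfolding sum.distrib[symmetric]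
    by (rule sum.cong) (auto simp: insert_control_points_def algebra_simps numeral_2_eq_2)
  also have "\<dots> = spline (insertion d) x"
    by (simp add: spline_of_def insert_control_points_def)
  finally show "coarse_spline d x = spline (insertion d) x" .
qed

text \<open>The norm refers to control points by a definite description; by their uniqueness those
  of the error are \<open>insertion d - c\<close>.\<close>

lemma knot_norm_coarse_diff:
  assumes "d \<in> carrier_vec (n - 1)" "c \<in> carrier_vec n"
  shows "knot_norm p (\<xi> (p + 1)) (\<xi> (n + 1)) \<xi> n (\<lambda>x. coarse_spline d x - spline c x) =
    sqrt (\<Sum>i = 1..n. (insertion d $ (i - 1) - c $ (i - 1))\<^sup>2 * (knot_weight p \<xi> i)\<^sup>2)"
proof -
  have I: "insertion d \<in> carrier_vec n" by (simp add: insert_control_points_def)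
  have "insertion d - c \<in> carrier_vec n" using I assms(2) by simp
  note cp = control_points_spline[OF this]
  have "knot_norm p (\<xi> (p + 1)) (\<xi> (n + 1)) \<xi> n (\<lambda>x. coarse_spline d x - spline c x) =
    sqrt (\<Sum>i = 1..n. ((insertion d - c) $ (i - 1))\<^sup>2 * (knot_weight p \<xi> i)\<^sup>2)"
    unfolding coarse_spline_eq[OF assms(1)] spline_diff[OF I assms(2)] knot_norm_def cp ..
  also have "\<dots> = sqrt (\<Sum>i = 1..n. (insertion d $ (i - 1) - c $ (i - 1))\<^sup>2 * (knot_weight p \<xi> i)\<^sup>2)"
    by (intro arg_cong[of _ _ sqrt] sum.cong) (use assms in auto)
  finally show ?thesis .
qed

text \<open>Row \<open>k\<close> of the local block, counted from 0, is the global index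
  \<open>r - p - 1 + k\<close>. For \<open>k = 0\<close> the guard and the quotient both give 1, and
  for index \<open>r\<close> both give 0.\<close>

lemma insertion_weight_local:
  assumes "k \<le> p + 1 - l"
  shows "W (r - p - 1 + k) = insertion_coeff p r \<xi> (k + 1)"
proof -
  define i where "i = r - p - 1 + k"
  have i: "i \<in> {1..n}" "r - p - 2 + (k + 1) = i" "r - 1 + (k + 1) = i + p + 1" "i \<le> r"
    "i + p + 1 = r + k"
    using assms r l by (auto simp: i_def)
  show ?thesis
    unfolding insertion_coeff_def i(2,3) unfolding i_def[symmetric]
    using knot_less[OF i(1)] i(4,5) by (cases "k = 0") (auto simp: insertion_weight_def)
qed

text \<open>These values decouple the local block: the two entries of the bidiagonal pattern that
  would fall outside \<open>A_loc\<close> are 0.\<close>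

lemma insertion_coeff_boundary:
  "insertion_coeff p r \<xi> 1 = 1" "insertion_coeff p r \<xi> (p + 2 - l) = 0"
proof -
  show "insertion_coeff p r \<xi> 1 = 1"
    using insertion_weight_local[of 0] r by (simp add: insertion_weight_def)
  have "r - p - 2 + (p + 2 - l) = r - l" using r l by simp
  then show "insertion_coeff p r \<xi> (p + 2 - l) = 0"
    using multiple by (simp add: insertion_coeff_def)
qed

text \<open>The index lies before the first occurrence of the removed knot value. Hence the diagonal
  of \<open>A_loc\<close> is positive, which gives full rank.\<close>

lemma insertion_coeff_pos:
  assumes "k < p + 1 - l"
  shows "0 < insertion_coeff p r \<xi> (k + 1)"
proof -
  define i where "i = r - p - 1 + k"
  have i: "i \<in> {1..n}" "r - p - 2 + (k + 1) = i" "r - 1 + (k + 1) = i + p + 1"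
    "i \<le> r - l - 1"
    using assms r l by (auto simp: i_def)
  have "\<xi> i \<le> \<xi> (r - l - 1)" using i r by (intro knot_le) auto
  then show ?thesis
    unfolding insertion_coeff_def i(2,3) using multiple(2) knot_less[OF i(1)] by simp
qed

text \<open>Between \<open>r - l\<close> and \<open>r\<close> all knots equal \<open>\<xi> r\<close>
  by monotonicity, so the numerator vanishes.\<close>

lemma insertion_weight_last:
  assumes "r - l \<le> i"
  shows "W i = 0"
proof (cases "i < r")
  case True
  have "\<xi> (r - l) \<le> \<xi> i" "\<xi> i \<le> \<xi> r" using True assms r l by (auto intro!: knot_le)
  moreover have "\<not> i + p + 1 \<le> r" using assms r l by arith
  ultimately show ?thesis using multiple by (simp add: insertion_weight_def)
qed (use r in \<open>simp add: insertion_weight_def\<close>)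

section \<open>The local matrices\<close>

lemma A_loc_carrier: "A_loc p l r \<xi> \<in> carrier_mat (p + 2 - l) (p + 1 - l)"
  unfolding A_loc_def by (rule mat_carrier)

lemma E_loc_carrier: "E_loc p l r \<xi> \<in> carrier_mat (p + 2 - l) (p + 2 - l)"
  by (simp add: E_loc_def)

lemma B_loc_carrier: "B_loc p l r \<xi> \<in> carrier_mat (p + 2 - l) (p + 1 - l)"
  unfolding B_loc_def by (rule mult_carrier_mat[OF E_loc_carrier A_loc_carrier])

lemma A_loc_mult_vec:
  assumes "z \<in> carrier_vec (p + 1 - l)" "k < p + 2 - l"
  shows "(A_loc p l r \<xi> *\<^sub>v z) $ k =
    (if k < p + 1 - l then insertion_coeff p r \<xi> (k + 1) * z $ k else 0) +
    (if k = 0 then 0 else (1 - insertion_coeff p r \<xi> (k + 1)) * z $ (k - 1))"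
proof -
  let ?\<alpha> = "insertion_coeff p r \<xi> (k + 1)"
  have "(A_loc p l r \<xi> *\<^sub>v z) $ k =
      (\<Sum>j = 0..<p + 1 - l. (if k = j then ?\<alpha> else if k = j + 1 then 1 - ?\<alpha> else 0) * z $ j)"
    using assms by (simp add: A_loc_def scalar_prod_def)
  \<comment> \<open>Row 0 has no subdiagonal entry; without the guard the truncated
    \<open>k - 1\<close> would select column 0.\<close>
  also have "\<dots> = (\<Sum>j = 0..<p + 1 - l. (if j = k then ?\<alpha> * z $ j else 0)) +
      (\<Sum>j = 0..<p + 1 - l. (if j = k - 1 then (if k = 0 then 0 else (1 - ?\<alpha>) * z $ j) else 0))"
    unfolding sum.distrib[symmetric] by (rule sum.cong) auto
  also have "\<dots> = (if k < p + 1 - l then ?\<alpha> * z $ k else 0) +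
      (if k = 0 then 0 else (1 - ?\<alpha>) * z $ (k - 1))"
    using assms l by (auto simp: sum.delta)
  finally show ?thesis .
qed

lemma E_loc_mult_vec:
  assumes "y \<in> carrier_vec (p + 2 - l)" "k < p + 2 - l"
  shows "(E_loc p l r \<xi> *\<^sub>v y) $ k = knot_weight p \<xi> (r - p - 1 + k) * y $ k"
proof -
  have "r - p - 2 + (j + 1) = r - p - 1 + j" for j using r by simp
  then have "E_loc p l r \<xi> = mat_diag (p + 2 - l) (\<lambda>j. knot_weight p \<xi> (r - p - 1 + j))"
    unfolding E_loc_def by (simp only:)
  then show ?thesis using mat_diag_mult_vec[OF assms] by simp
qed

lemma B_loc_mult_vec:
  assumes "z \<in> carrier_vec (p + 1 - l)" "k < p + 2 - l"
  shows "(B_loc p l r \<xi> *\<^sub>v z) $ k = knot_weight p \<xi> (r - p - 1 + k) * (A_loc p l r \<xi> *\<^sub>v z) $ k"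
proof -
  have "B_loc p l r \<xi> *\<^sub>v z = E_loc p l r \<xi> *\<^sub>v (A_loc p l r \<xi> *\<^sub>v z)"
    unfolding B_loc_def by (rule assoc_mult_mat_vec[OF E_loc_carrier A_loc_carrier assms(1)])
  moreover have "A_loc p l r \<xi> *\<^sub>v z \<in> carrier_vec (p + 2 - l)"
    by (rule mult_mat_vec_carrier[OF A_loc_carrier assms(1)])
  ultimately show ?thesis using E_loc_mult_vec assms by simp
qed

text \<open>Forward substitution: \<open>A_loc\<close> is lower bidiagonal with positive diagonal,
  and the knot weights that scale its rows are positive.\<close>

lemma B_loc_inj:
  assumes z: "z \<in> carrier_vec (p + 1 - l)" and zero: "B_loc p l r \<xi> *\<^sub>v z = 0\<^sub>v (p + 2 - l)"
  shows "z = 0\<^sub>v (p + 1 - l)"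
proof (rule eq_vecI)
  have "z $ k = 0" if "k < p + 1 - l" for k
    using that
  proof (induction k)
    case 0
    have "r - p - 1 + 0 \<in> {1..n}" using r by simp arith
    then have "knot_weight p \<xi> (r - p - 1 + 0) \<noteq> 0" by (metis knot_weight_pos less_irrefl)
    then have "(A_loc p l r \<xi> *\<^sub>v z) $ 0 = 0"
      using B_loc_mult_vec[OF z, of 0] zero 0 by simp
    then show ?case using A_loc_mult_vec[OF z, of 0] insertion_coeff_boundary(1) 0 by simp
  next
    case (Suc k)
    have "r - p - 1 + Suc k \<in> {1..n}" using r l Suc.prems by simp
    then have "knot_weight p \<xi> (r - p - 1 + Suc k) \<noteq> 0" by (metis knot_weight_pos less_irrefl)
    then have "(A_loc p l r \<xi> *\<^sub>v z) $ Suc k = 0"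
      using B_loc_mult_vec[OF z, of "Suc k"] zero Suc.prems by simp
    then show ?case
      using A_loc_mult_vec[OF z, of "Suc k"] insertion_coeff_pos[OF Suc.prems] Suc by simp
  qed
  then show "z $ k = 0\<^sub>v (p + 1 - l) $ k" if "k < dim_vec (0\<^sub>v (p + 1 - l) :: real vec)" for k
    using that by simp
qed (use z in simp)

section \<open>Splitting the error and solving the local problem\<close>

abbreviation "first_error d c \<equiv>
  \<Sum>i = 1..r - p - 2. (d $ (i - 1) - c $ (i - 1))\<^sup>2 * (knot_weight p \<xi> i)\<^sup>2"
text \<open>Behind the removed knot, coarse number \<open>i - 1\<close> meets fine number
  \<open>i\<close>; counting from 0 turns these into \<open>i - 2\<close> and
  \<open>i - 1\<close>.\<close>

abbreviation "last_error d c \<equiv>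
  \<Sum>i = r - l + 1..n. (d $ (i - 2) - c $ (i - 1))\<^sup>2 * (knot_weight p \<xi> i)\<^sup>2"
abbreviation "local_residual c z \<equiv>
  B_loc p l r \<xi> *\<^sub>v z - E_loc p l r \<xi> *\<^sub>v subvec c (r - p - 1) (r - l)"

lemma local_residual_sq:
  fixes d c :: "real vec"
  defines "z \<equiv> subvec d (r - p - 1) (r - l - 1)"
  shows "(norm2 (local_residual c z))\<^sup>2 =
    (\<Sum>i = r - p - 1..r - l. (insertion d $ (i - 1) - c $ (i - 1))\<^sup>2 * (knot_weight p \<xi> i)\<^sup>2)"
proof -
  let ?v = "local_residual c z"
  have len: "r - l + 1 - (r - p - 1) = p + 2 - l" "r - l - 1 + 1 - (r - p - 1) = p + 1 - l"
    using r l by auto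
  have z: "z \<in> carrier_vec (p + 1 - l)" and y: "subvec c (r - p - 1) (r - l) \<in> carrier_vec (p + 2 - l)"
    using len by (simp_all add: z_def subvec_def)
  have dim: "dim_vec ?v = p + 2 - l" using E_loc_carrier by simp
  have entry: "?v $ k = knot_weight p \<xi> (r - p - 1 + k) *
      (insertion d $ (r - p - 1 + k - 1) - c $ (r - p - 1 + k - 1))" if k: "k < p + 2 - l" for k
  proof -
    let ?\<alpha> = "insertion_coeff p r \<xi> (k + 1)"
    have W: "W (r - p - 1 + k) = ?\<alpha>" using k by (intro insertion_weight_local) simp
    have "insertion d $ (r - p - 1 + k - 1) =
        ?\<alpha> * d $ (r - p - 1 + k - 1) + (1 - ?\<alpha>) * d $ (r - p - 1 + k - 1 - 1)"
    proof -
      have "r - p - 1 + k - 1 + 1 = r - p - 1 + k" "r - p - 1 + k - 1 < n" using r l k by auto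
      then show ?thesis using W by (simp add: insert_control_points_def)
    qed
    also have "\<dots> = (A_loc p l r \<xi> *\<^sub>v z) $ k"
    proof -
      \<comment> \<open>Where an entry of \<open>d\<close> falls outside \<open>z\<close>, its
        coefficient vanishes by \<open>insertion_coeff_boundary\<close>: in the last row here, in
        row 0 for the other summand.\<close>
      have "?\<alpha> * d $ (r - p - 1 + k - 1) = (if k < p + 1 - l then ?\<alpha> * z $ k else 0)"
      proof (cases "k < p + 1 - l")
        case False
        then have "k + 1 = p + 2 - l" using k by simp
        then show ?thesis using insertion_coeff_boundary(2) by simp
      qed (use len in \<open>simp add: z_def subvec_def\<close>)
      moreover have "(1 - ?\<alpha>) * d $ (r - p - 1 + k - 1 - 1) =
          (if k = 0 then 0 else (1 - ?\<alpha>) * z $ (k - 1))"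
      proof (cases k)
        case (Suc k')
        then have "k' < p + 1 - l" using k by simp
        then have "z $ k' = d $ (r - p - 1 + k' - 1)" using len by (simp add: z_def subvec_def)
        moreover have "r - p - 1 + Suc k' - 1 - 1 = r - p - 1 + k' - 1" by simp
        ultimately show ?thesis by (simp only: Suc nat.distinct if_False diff_Suc_1)
      qed (use insertion_coeff_boundary(1) in simp)
      ultimately show ?thesis using A_loc_mult_vec[OF z k] by simp
    qed
    finally have "insertion d $ (r - p - 1 + k - 1) = (A_loc p l r \<xi> *\<^sub>v z) $ k" .
    moreover have "subvec c (r - p - 1) (r - l) $ k = c $ (r - p - 1 + k - 1)"
      using k len by (simp add: subvec_def)
    moreover have "?v $ k = (B_loc p l r \<xi> *\<^sub>v z) $ k -
        (E_loc p l r \<xi> *\<^sub>v subvec c (r - p - 1) (r - l)) $ k"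
      by (rule index_minus_vec) (use E_loc_carrier k in simp)
    ultimately show ?thesis
      using B_loc_mult_vec[OF z k] E_loc_mult_vec[OF y k] by (simp only: right_diff_distrib)
  qed
  have "(norm2 ?v)\<^sup>2 = (\<Sum>k = 0..<p + 2 - l. (?v $ k)\<^sup>2)"
  proof -
    have "?v \<bullet> ?v = (\<Sum>k = 0..<p + 2 - l. (?v $ k)\<^sup>2)"
      unfolding scalar_prod_def dim by (simp only: power2_eq_square)
    then show ?thesis by (simp add: norm2_def sum_nonneg)
  qed
  also have "\<dots> = (\<Sum>k = 0..<p + 2 - l. (insertion d $ (k + (r - p - 1) - 1) -
      c $ (k + (r - p - 1) - 1))\<^sup>2 * (knot_weight p \<xi> (k + (r - p - 1)))\<^sup>2)"
  proof (rule sum.cong)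
    fix k assume "k \<in> {0..<p + 2 - l}"
    then show "(?v $ k)\<^sup>2 = (insertion d $ (k + (r - p - 1) - 1) -
      c $ (k + (r - p - 1) - 1))\<^sup>2 * (knot_weight p \<xi> (k + (r - p - 1)))\<^sup>2"
      using entry[of k] by (simp only: add.commute[of k] power_mult_distrib mult.commute atLeastLessThan_iff)
  qed simp
  also have "\<dots> = (\<Sum>i = 0 + (r - p - 1)..<p + 2 - l + (r - p - 1).
      (insertion d $ (i - 1) - c $ (i - 1))\<^sup>2 * (knot_weight p \<xi> i)\<^sup>2)"
    by (rule sum.shift_bounds_nat_ivl[symmetric])
  also have "{0 + (r - p - 1)..<p + 2 - l + (r - p - 1)} = {r - p - 1..r - l}"
    using r l by auto
  finally show ?thesis .
qed

text \<open>The three parts involve disjoint blocks of entries of \<open>d\<close>, so each can be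
  minimized on its own.\<close>

lemma squared_error_split:
  "(\<Sum>i = 1..n. (insertion d $ (i - 1) - c $ (i - 1))\<^sup>2 * (knot_weight p \<xi> i)\<^sup>2) =
    first_error d c + (norm2 (local_residual c (subvec d (r - p - 1) (r - l - 1))))\<^sup>2 + last_error d c"
proof -
  let ?f = "\<lambda>i. (insertion d $ (i - 1) - c $ (i - 1))\<^sup>2 * (knot_weight p \<xi> i)\<^sup>2"
  have "{1..n} = {1..r - p - 2} \<union> {r - p - 1..r - l} \<union> {r - l + 1..n}"
    using r l by auto
  then have "sum ?f {1..n} = sum ?f {1..r - p - 2} + sum ?f {r - p - 1..r - l} + sum ?f {r - l + 1..n}"
    using r l by (simp only:, subst sum.union_disjoint, simp, simp, force,
        subst sum.union_disjoint) auto
  moreover have "sum ?f {1..r - p - 2} = first_error d c"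
  proof (rule sum.cong)
    fix i assume i: "i \<in> {1..r - p - 2}"
    then have "i + p + 1 \<le> r" unfolding atLeastAtMost_iff by arith
    then have "W i = 1" by (simp add: insertion_weight_def)
    moreover have "i - 1 + 1 = i" "i - 1 < n" using i r by auto
    ultimately have "insertion d $ (i - 1) = d $ (i - 1)"
      by (simp add: insert_control_points_def)
    then show "?f i = (d $ (i - 1) - c $ (i - 1))\<^sup>2 * (knot_weight p \<xi> i)\<^sup>2" by simp
  qed simp
  moreover have "sum ?f {r - l + 1..n} = last_error d c"
  proof (rule sum.cong)
    fix i assume i: "i \<in> {r - l + 1..n}"
    then have "W i = 0" by (intro insertion_weight_last) simp
    moreover have "i - 1 + 1 = i" "i - 1 - 1 = i - 2" "i - 1 < n" using i r by auto
    ultimately have "insertion d $ (i - 1) = d $ (i - 2)"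
      by (simp add: insert_control_points_def)
    then show "?f i = (d $ (i - 2) - c $ (i - 1))\<^sup>2 * (knot_weight p \<xi> i)\<^sup>2" by simp
  qed simp
  ultimately show ?thesis by (simp only: local_residual_sq)
qed

lemma best_approximation:
  fixes c :: "real vec"
  assumes c: "c \<in> carrier_vec n"
  defines "error \<equiv> \<lambda>d. knot_norm p (\<xi> (p + 1)) (\<xi> (n + 1)) \<xi> n (\<lambda>x. coarse_spline d x - spline c x)"
  obtains d where "d \<in> carrier_vec (n - 1)"
    and "\<And>d'. d' \<in> carrier_vec (n - 1) \<Longrightarrow> d' \<noteq> d \<Longrightarrow> error d < error d'"
    and "subvec d 1 (r - p - 2) = subvec c 1 (r - p - 2)"
    and "subvec d (r - l) (n - 1) = subvec c (r - l + 1) n"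
    and "least_squares_solutions (B_loc p l r \<xi>) (E_loc p l r \<xi> *\<^sub>v subvec c (r - p - 1) (r - l)) =
      {subvec d (r - p - 1) (r - l - 1)}"
    and "error d = norm2 (local_residual c (subvec d (r - p - 1) (r - l - 1)))"
proof -
  have len: "r - l + 1 - (r - p - 1) = p + 2 - l" "r - l - 1 + 1 - (r - p - 1) = p + 1 - l"
    using r l by auto
  have y: "E_loc p l r \<xi> *\<^sub>v subvec c (r - p - 1) (r - l) \<in> carrier_vec (p + 2 - l)"
    by (rule mult_mat_vec_carrier[OF E_loc_carrier]) (use len in \<open>simp add: subvec_def\<close>)
  obtain x where x: "x \<in> carrier_vec (p + 1 - l)"
    and x_min: "\<And>z. z \<in> carrier_vec (p + 1 - l) \<Longrightarrow> z \<noteq> x \<Longrightarrow>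
        norm2 (local_residual c x) < norm2 (local_residual c z)"
    using full_rank_least_squares[OF B_loc_carrier y B_loc_inj] by blast
  \<comment> \<open>The blocks are glued at the zero-based positions \<open>r - p - 2\<close> and
    \<open>r - l - 1\<close>; in the last one the coarse index lags one behind the fine
    index.\<close>
  define d where "d = vec (n - 1) (\<lambda>k. if k < r - p - 2 then c $ k
      else if k < r - l - 1 then x $ (k - (r - p - 2)) else c $ (k + 1))"
  have d: "d \<in> carrier_vec (n - 1)" by (simp add: d_def)
  have d_first: "d $ k = c $ k" if "k < r - p - 2" for k
    using that r by (simp add: d_def)
  have d_last: "d $ k = c $ (k + 1)" if "r - l - 1 \<le> k" "k < n - 1" for k
  proof -
    have "\<not> k < r - p - 2" using that l by arith
    then show ?thesis using that by (simp add: d_def)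
  qed
  have d_loc: "subvec d (r - p - 1) (r - l - 1) = x"
  proof (rule eq_vecI)
    fix k assume "k < dim_vec x"
    then have "k < p + 1 - l" using x by simp
    then have k: "k < r - l - 1 + 1 - (r - p - 1)" "r - p - 1 + k - 1 < n - 1"
      "\<not> r - p - 1 + k - 1 < r - p - 2" "r - p - 1 + k - 1 < r - l - 1"
      "r - p - 1 + k - 1 - (r - p - 2) = k"
      using r l by arith+
    then show "subvec d (r - p - 1) (r - l - 1) $ k = x $ k"
      unfolding subvec_def d_def by (simp only: index_vec if_True if_False)
  qed (use x len in \<open>simp add: subvec_def\<close>)
  have error: "error d' = sqrt (first_error d' c +
      (norm2 (local_residual c (subvec d' (r - p - 1) (r - l - 1))))\<^sup>2 + last_error d' c)"
    if "d' \<in> carrier_vec (n - 1)" for d'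
    unfolding error_def knot_norm_coarse_diff[OF that c] squared_error_split ..
  have norm2_nonneg: "0 \<le> norm2 v" for v
    by (simp add: norm2_def scalar_prod_def sum_nonneg)
  have first0: "first_error d c = 0"
    by (rule sum.neutral) (use d_first in auto)
  have last0: "last_error d c = 0"
  proof (rule sum.neutral, rule ballI)
    fix i assume i: "i \<in> {r - l + 1..n}"
    then have "r - l - 1 \<le> i - 2" "i - 2 < n - 1" "i - 2 + 1 = i - 1" using r l by auto
    then show "(d $ (i - 2) - c $ (i - 1))\<^sup>2 * (knot_weight p \<xi> i)\<^sup>2 = 0"
      using d_last[of "i - 2"] by simp
  qed
  have error_d: "error d = norm2 (local_residual c x)"
    unfolding error[OF d] d_loc first0 last0 using norm2_nonneg by simp
  have less: "error d < error d'" if d': "d' \<in> carrier_vec (n - 1)" "d' \<noteq> d" for d'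
  proof (rule ccontr)
    let ?z = "subvec d' (r - p - 1) (r - l - 1)"
    have zc: "?z \<in> carrier_vec (p + 1 - l)" using len by (simp add: subvec_def)
    assume "\<not> error d < error d'"
    then have "error d' \<le> norm2 (local_residual c x)" using error_d by simp
    \<comment> \<open>A competitor that is no worse has three nonnegative parts whose sum is at most
      the minimal local part. Hence its outer parts vanish and its local part is minimal
      too.\<close>
    then have "first_error d' c + (norm2 (local_residual c ?z))\<^sup>2 + last_error d' c \<le>
        (norm2 (local_residual c x))\<^sup>2"
      unfolding error[OF d'(1)] by (rule sqrt_le_D)
    moreover have "0 \<le> first_error d' c" "0 \<le> last_error d' c"
      by (intro sum_nonneg; simp)+
    moreover have "(norm2 (local_residual c x))\<^sup>2 \<le> (norm2 (local_residual c ?z))\<^sup>2"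
    proof (cases "?z = x")
      case False
      show ?thesis by (rule power_mono[OF less_imp_le[OF x_min[OF zc False]] norm2_nonneg])
    qed simp
    ultimately have eq: "first_error d' c = 0" "last_error d' c = 0"
        "(norm2 (local_residual c ?z))\<^sup>2 \<le> (norm2 (local_residual c x))\<^sup>2"
      by linarith+
    have "norm2 (local_residual c ?z) \<le> norm2 (local_residual c x)"
      using eq(3) norm2_nonneg by (rule power2_le_imp_le)
    then have z: "?z = x" using x_min[OF zc] by (meson not_less)
    \<comment> \<open>Nonzero weights turn the vanishing sums into equality of the single
      entries.\<close>
    have weight: "knot_weight p \<xi> i \<noteq> 0" if "1 \<le> i" "i \<le> n" for i
      using knot_weight_pos[of i] that by auto
    have first: "d' $ k = c $ k" if "k < r - p - 2" for k
    proof -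
      have k: "k + 1 \<in> {1..r - p - 2}" using that by simp
      have "\<forall>i\<in>{1..r - p - 2}. (d' $ (i - 1) - c $ (i - 1))\<^sup>2 * (knot_weight p \<xi> i)\<^sup>2 = 0"
        by (rule iffD1[OF sum_nonneg_eq_0_iff eq(1)]) simp_all
      from bspec[OF this k] show ?thesis using weight[of "k + 1"] that r by simp
    qed
    have last: "d' $ k = c $ (k + 1)" if "r - l - 1 \<le> k" "k < n - 1" for k
    proof -
      have k: "k + 2 \<in> {r - l + 1..n}" using that by auto
      have "\<forall>i\<in>{r - l + 1..n}. (d' $ (i - 2) - c $ (i - 1))\<^sup>2 * (knot_weight p \<xi> i)\<^sup>2 = 0"
        by (rule iffD1[OF sum_nonneg_eq_0_iff eq(2)]) simp_all
      from bspec[OF this k] show ?thesis using weight[of "k + 2"] k by simp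
    qed
    have "d' = d"
    proof (rule eq_vecI)
      fix k assume "k < dim_vec d"
      then have k: "k < n - 1" using d by simp
      consider "k < r - p - 2" | "r - l - 1 \<le> k" | "r - p - 2 \<le> k" "k < r - l - 1" by linarith
      then show "d' $ k = d $ k"
      proof cases
        case 3
        define i where "i = k - (r - p - 2)"
        have i: "i < r - l - 1 + 1 - (r - p - 1)" "r - p - 1 + i - 1 = k"
          using 3 r l by (auto simp: i_def)
        have "?z $ i = subvec d (r - p - 1) (r - l - 1) $ i" using z d_loc by simp
        then show ?thesis using i unfolding subvec_def by (simp only: index_vec)
      qed (use first d_first last d_last k in simp_all)
    qed (use d d' in simp)
    then show False using d'(2) by simp
  qed
  show thesis
  proof (rule that[OF d less])
    show "subvec d 1 (r - p - 2) = subvec c 1 (r - p - 2)"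
      by (rule eq_vecI) (auto simp: subvec_def d_first)
    show "subvec d (r - l) (n - 1) = subvec c (r - l + 1) n"
    proof (rule eq_vecI)
      fix k assume "k < dim_vec (subvec c (r - l + 1) n)"
      then have k: "k < n + 1 - (r - l + 1)" by (simp add: subvec_def)
      then have "r - l - 1 \<le> r - l + k - 1" "r - l + k - 1 < n - 1" "k < n - 1 + 1 - (r - l)"
        "r - l + k - 1 + 1 = r - l + 1 + k - 1" using r l by auto
      then show "subvec d (r - l) (n - 1) $ k = subvec c (r - l + 1) n $ k"
        using k d_last[of "r - l + k - 1"] unfolding subvec_def by (simp only: index_vec)
    qed (use r in \<open>simp add: subvec_def\<close>)
    show "least_squares_solutions (B_loc p l r \<xi>) (E_loc p l r \<xi> *\<^sub>v subvec c (r - p - 1) (r - l)) =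
      {subvec d (r - p - 1) (r - l - 1)}"
      unfolding d_loc least_squares_solutions_def carrier_matD(2)[OF B_loc_carrier]
      using is_arg_min_strict[where P = "\<lambda>z. z \<in> carrier_vec (p + 1 - l)"
          and f = "\<lambda>z. norm2 (local_residual c z)", OF x x_min] by blast
    show "error d = norm2 (local_residual c (subvec d (r - p - 1) (r - l - 1)))"
      unfolding d_loc by (rule error_d)
  qed
qed

end

section \<open>Basic knot vectors and the final result\<close>

lemma interior_knot_removable:
  fixes \<zeta> \<xi> :: "nat \<Rightarrow> real" and m :: "nat \<Rightarrow> nat"
  assumes incr: "strict_mono_on {1..N} \<zeta>"
    and mult: "\<forall>j\<in>{2..N - 1}. 1 \<le> m j \<and> m j \<le> p + 1"
    and knots: "basic_knot_vector p N \<zeta> m \<xi>"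
    and j0: "2 \<le> j0" "j0 \<le> N - 1"
  shows "removable_knot p (spline_dim p N m) \<xi> (p + 1 + (\<Sum>j = 2..j0. m j)) (m j0 - 1)"
proof -
  \<comment> \<open>\<open>M j\<close> is the largest index of a knot equal to \<open>\<zeta> (j - 1)\<close>, so \<open>[\<xi> (M j), \<xi> (M j + 1))\<close> is the
    nontrivial knot span \<open>[\<zeta> (j - 1), \<zeta> j)\<close>.\<close>
  define M where "M = (\<lambda>j. p + 1 + (\<Sum>i = 2..<j. m i))"
  have M_Suc: "M (Suc j) = M j + m j" if "2 \<le> j" for j
    using that by (simp add: M_def)
  have M_2: "M 2 = p + 1" by (simp add: M_def)
  have M_mono: "M i \<le> M j" if "i \<le> j" for i j
    unfolding M_def using that by (intro add_left_mono sum_mono2) auto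
  have "{2..<N} = {2..N - 1}" using j0 by auto
  then have M_N: "M N = spline_dim p N m" by (simp add: M_def spline_dim_def)
  have "{2..<Suc j0} = {2..j0}" by auto
  then have M_j0: "p + 1 + (\<Sum>j = 2..j0. m j) = M (Suc j0)" by (simp add: M_def)
  have m: "1 \<le> m j" "m j \<le> p + 1" if "2 \<le> j" "j < N" for j
    using mult that by auto
  have \<xi>: "\<xi> (M j + k) = \<zeta> j" if "2 \<le> j" "j < N" "1 \<le> k" "k \<le> m j" for j k
    using knots that unfolding basic_knot_vector_def M_def by auto
  have \<xi>_M: "\<xi> (M j) = \<zeta> (j - 1)" if j: "2 \<le> j" "j \<le> N" for j
  proof (cases "j = 2")
    case True
    then show ?thesis using knots M_2 by (simp add: basic_knot_vector_def)
  next
    case False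
    then have "M j = M (j - 1) + m (j - 1)" using M_Suc[of "j - 1"] j by simp
    then show ?thesis using \<xi>[of "j - 1" "m (j - 1)"] m[of "j - 1"] j False by simp
  qed
  have \<xi>_M1: "\<xi> (M j + 1) = \<zeta> j" if "2 \<le> j" "j \<le> N" for j
  proof (cases "j = N")
    case True
    then show ?thesis using knots M_N by (simp add: basic_knot_vector_def)
  next
    case False
    then show ?thesis using \<xi>[of j 1] m[of j] that by simp
  qed
  have \<zeta>: "\<zeta> (j - 1) < \<zeta> j" if "2 \<le> j" "j \<le> N" for j
    by (rule strict_mono_onD[OF incr]) (use that in auto)
  have jump: "\<xi> (M j) < \<xi> (M j + 1)" if "2 \<le> j" "j \<le> N" for j
    using \<xi>_M \<xi>_M1 \<zeta> that by simp
  have mj0: "1 \<le> m j0" "m j0 \<le> p + 1" using m[of j0] j0 by auto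
  have M_removed: "M (Suc j0) = M j0 + m j0" using M_Suc j0 by simp
  show ?thesis
    unfolding M_j0 M_N[symmetric]
  proof unfold_locales
    show "mono_on {1..M N + p + 1} \<xi>" using knots M_N by (simp add: basic_knot_vector_def)
    fix i assume i: "i \<in> {1..M N}"
    \<comment> \<open>The first nontrivial span at or after \<open>i\<close>. For
      \<open>j > 2\<close> minimality gives \<open>M (j - 1) < i\<close>, and a multiplicity of at
      most \<open>p + 1\<close> then gives \<open>M j \<le> i + p\<close>.\<close>
    define j where "j = (LEAST j. 2 \<le> j \<and> i \<le> M j)"
    have N: "2 \<le> N \<and> i \<le> M N" using i j0 by auto
    have j: "2 \<le> j" "i \<le> M j" using LeastI[of "\<lambda>j. 2 \<le> j \<and> i \<le> M j", OF N] by (simp_all add: j_def)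
    have jN: "j \<le> N" unfolding j_def by (rule Least_le[of "\<lambda>j. 2 \<le> j \<and> i \<le> M j", OF N])
    have "M j \<le> i + p"
    proof (cases "j = 2")
      case False
      then have "\<not> (2 \<le> j - 1 \<and> i \<le> M (j - 1))"
        unfolding j_def using j by (intro not_less_Least) (auto simp: j_def)
      moreover have "M j = M (j - 1) + m (j - 1)" "m (j - 1) \<le> p + 1"
        using M_Suc[of "j - 1"] m[of "j - 1"] j jN False by auto
      ultimately show ?thesis using False j by auto
    qed (use i M_2 in auto)
    moreover have "M j \<in> {p + 1..M N}" using M_mono[OF j(1)] M_mono[OF jN] M_2 by simp
    ultimately show "\<exists>j\<in>{p + 1..M N}. i \<le> j \<and> j \<le> i + p \<and> \<xi> j < \<xi> (j + 1)"
      using j jump[OF j(1) jN] by blast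
  next
    have "p + 1 \<le> M j0" using M_mono[OF j0(1)] M_2 by simp
    then show "p + 2 \<le> M (Suc j0)" using M_removed mj0 by simp
    show "M (Suc j0) \<le> M N" using j0 by (intro M_mono) auto
    show "m j0 - 1 \<le> p" using mj0 by simp
    \<comment> \<open>The copies of \<open>\<zeta> j0\<close> occupy the indices
      \<open>M j0 + 1\<close> to \<open>M (Suc j0)\<close>, and the knot before them is
      \<open>\<zeta> (j0 - 1)\<close>.\<close>
    have idx: "M (Suc j0) - (m j0 - 1) = M j0 + 1" "M (Suc j0) - (m j0 - 1) - 1 = M j0"
      using M_removed mj0 by auto
    show "\<xi> (M (Suc j0) - (m j0 - 1)) = \<xi> (M (Suc j0))"
      unfolding idx using \<xi>_M1[of j0] \<xi>_M[of "Suc j0"] j0 by simp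
    show "\<xi> (M (Suc j0) - (m j0 - 1) - 1) < \<xi> (M (Suc j0))"
      unfolding idx using \<xi>_M[of j0] \<xi>_M[of "Suc j0"] \<zeta>[of j0] j0 by simp
  qed
qed

theorem theorem3p2:
  fixes p N j0 n i0 l :: nat
    and \<zeta> \<xi> \<xi>h :: "nat \<Rightarrow> real"
    and m :: "nat \<Rightarrow> nat"
    and a b :: real
    and s :: "real \<Rightarrow> real"
    and c :: "real vec"
    and S Sh :: "(real \<Rightarrow> real) set"
  assumes "1 \<le> p"
    and "strict_mono_on {1..N} \<zeta>"
    and "a = \<zeta> 1"
    and "b = \<zeta> N"
    and "\<forall>j\<in>{2..N - 1}. 1 \<le> m j \<and> m j \<le> p + 1"
    and "n = spline_dim p N m"
    and "S = spline_space p N \<zeta> m"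
    and "basic_knot_vector p N \<zeta> m \<xi>"
    and "2 \<le> j0"
    and "j0 \<le> N - 1"
    and "i0 = p + 1 + (\<Sum>j = 2..j0. m j)"
    and "l = m j0 - 1"
    and "\<xi>h = remove_knot i0 \<xi>"
    and "Sh = bspline_span p a b \<xi>h (n - 1)"
    and "s \<in> S"
    and "c \<in> carrier_vec n"
    and "s = spline_of p a b \<xi> c"
  shows "(\<exists>!sh. is_arg_min (\<lambda>g. knot_norm p a b \<xi> n (\<lambda>x. g x - s x)) (\<lambda>g. g \<in> Sh) sh) \<and>
    (\<forall>sh ch.
       is_arg_min (\<lambda>g. knot_norm p a b \<xi> n (\<lambda>x. g x - s x)) (\<lambda>g. g \<in> Sh) sh \<and>
       ch \<in> carrier_vec (n - 1) \<and> sh = spline_of p a b \<xi>h ch \<longrightarrow>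
         subvec ch 1 (i0 - p - 2) = subvec c 1 (i0 - p - 2) \<and>
         subvec ch (i0 - l) (n - 1) = subvec c (i0 - l + 1) n \<and>
         least_squares_solutions (B_loc p l i0 \<xi>)
             (E_loc p l i0 \<xi> *\<^sub>v subvec c (i0 - p - 1) (i0 - l)) =
           {subvec ch (i0 - p - 1) (i0 - l - 1)} \<and>
         (LEAST e. e \<in> (\<lambda>g. knot_norm p a b \<xi> n (\<lambda>x. g x - s x)) ` Sh) =
           norm2 (B_loc p l i0 \<xi> *\<^sub>v subvec ch (i0 - p - 1) (i0 - l - 1)
                  - E_loc p l i0 \<xi> *\<^sub>v subvec c (i0 - p - 1) (i0 - l)))"
proof -
  have n: "spline_dim p N m = n" using assms(6) by simp
  interpret removable_knot p n \<xi> i0 l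
    using interior_knot_removable[OF assms(2,5,8,9,10)] n assms(11,12) by simp
  have ab: "a = \<xi> (p + 1)" "b = \<xi> (n + 1)"
    using assms(3,4,8) n by (simp_all add: basic_knot_vector_def)
  define err where "err = (\<lambda>g. knot_norm p a b \<xi> n (\<lambda>x. g x - s x))"
  have Sh: "Sh = coarse_spline ` carrier_vec (n - 1)"
    using assms(13,14) ab by (simp add: bspline_span_def)
  have s: "s = spline c" using assms(17) ab by simp
  obtain d where d: "d \<in> carrier_vec (n - 1)"
    and d_min: "\<And>d'. d' \<in> carrier_vec (n - 1) \<Longrightarrow> d' \<noteq> d \<Longrightarrow>
        err (coarse_spline d) < err (coarse_spline d')"
    and local: "subvec d 1 (i0 - p - 2) = subvec c 1 (i0 - p - 2)"
      "subvec d (i0 - l) (n - 1) = subvec c (i0 - l + 1) n"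
      "least_squares_solutions (B_loc p l i0 \<xi>)
         (E_loc p l i0 \<xi> *\<^sub>v subvec c (i0 - p - 1) (i0 - l)) =
       {subvec d (i0 - p - 1) (i0 - l - 1)}"
      "err (coarse_spline d) = norm2 (local_residual c (subvec d (i0 - p - 1) (i0 - l - 1)))"
    using best_approximation[OF assms(16)] unfolding err_def s ab by blast
  have arg_min: "is_arg_min err (\<lambda>g. g \<in> Sh) g \<longleftrightarrow> g = coarse_spline d" for g
    by (rule is_arg_min_strict) (use d d_min in \<open>auto simp: Sh\<close>)
  have ex1: "\<exists>!sh. is_arg_min err (\<lambda>g. g \<in> Sh) sh" by (simp add: arg_min)
  \<comment> \<open>The minimum is attained, which gives \<open>LEAST\<close> over the reals its
    intended value.\<close>
  have least: "(LEAST e. e \<in> err ` Sh) = err (coarse_spline d)"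
  proof (rule Least_equality)
    show "err (coarse_spline d) \<in> err ` Sh" using d Sh by blast
    fix e assume "e \<in> err ` Sh"
    then show "err (coarse_spline d) \<le> e" using d_min unfolding Sh by force
  qed
  \<comment> \<open>Strictness in \<open>d_min\<close> also settles the coarse control points: a
    second vector for the same spline would make its error exceed itself.\<close>
  have unique: "ch = d"
    if "is_arg_min err (\<lambda>g. g \<in> Sh) sh \<and> ch \<in> carrier_vec (n - 1) \<and> sh = spline_of p a b \<xi>h ch"
    for sh ch
  proof (rule ccontr)
    assume "ch \<noteq> d"
    then have "err (coarse_spline d) < err (coarse_spline ch)" using that d_min by blast
    moreover have "sh = coarse_spline d" using that arg_min by blast
    moreover have "sh = coarse_spline ch" using that unfolding assms(13) ab by blast
    ultimately show False by simp
  qed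
  show ?thesis
    unfolding err_def[symmetric]
    by (rule conjI[OF ex1], intro allI impI, drule unique, hypsubst)
      (simp only: local least simp_thms)
qed

end
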